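(* Let $f_0:\mathbb{N}\to[0,\infty)$ satisfy $m_\kappa\langle f_0\rangle<\infty$ for a fixed $\kappa>\max\{\delta,1,2-\alpha_1-\beta_1\}$, and let $f(t)$ be the solution of the discrete equation $\frac{\partial f}{\partial t}=O[f]$ with initial data $f_0$. Suppose that, for a given $k>\max\{\delta,1,2-\alpha_1-\beta_1\}$, $m_k\langle f_0\rangle<\infty$. Then, for all $t\in[0,\infty)$, $$m_k\langle f(t)\rangle\le\max\bigl\{m_k\langle f_0\rangle,\;2\,\mathcal{B}_k\bigl(m_1\langle f_0\rangle\bigr)\bigr\}.$$
   Context: $\mathbb{N}=\{1,2,3,\dots\}$. Fix a mesh size $h>0$ and positive real parameters $\alpha_n,\beta_n$ ($n\in\{1,2,3\}$) and $\delta$ with $\delta>\max_{n\in\{1,2,3\}}(\alpha_n+\beta_n)$ and $\delta>2\alpha_1+\beta_1-1$. For $x,y\ge 0$ let $K_n(x,y)=x^{\alpha_n}y^{\alpha_n}(x+y)^{\beta_n}$ and $\gamma(x)=x^\delta$. For $f:\mathbb{N}\to\mathbb{R}$ and $i\in\mathbb{N}$ set $$S^{(1)}_i[f]=\sum_{j=1}^{i-1}K_1(jh,(i-j)h)f_jf_{i-j}-2\sum_{j=1}^\infty K_1(ih,jh)f_if_j,$$ and for $n\in\{2,3\}$ $$S^{(n)}_i[f]=-\sum_{j=1}^{i-1}K_n((i-j)h,jh)f_if_j+\sum_{j=i+1}^\infty K_n((j-i)h,ih)f_if_j+\sum_{j=i+1}^\infty K_n(ih,(j-i)h)f_jf_{j-i},$$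 $V_i[f]=\gamma(ih)f_i$, $S[f]=S^{(1)}[f]+S^{(2)}[f]+S^{(3)}[f]$, and $O[f]=S[f]-V[f]$. The moments are $m_k\langle f\rangle=\sum_{i=1}^\infty f_i\,(ih)^k$, $k\ge 0$. For $k>\max\{1,2-\alpha_1-\beta_1\}$ and $x\ge0$ define $$\mathcal{B}_k(x)=\Bigl(2\,\mathcal{C}_k\,x^{1+\frac{\delta+k-1}{\delta-2\alpha_1-\beta_1+1}+\frac{\delta}{k-1}}\Bigr)^{\frac{k-1}{\delta+k-1}},$$ where $\mathcal{C}_k$ is the positive constant $$\mathcal{C}_k=\frac{\delta-2\alpha_1-\beta_1+1}{\delta+k-1}\bigl[2^{\beta_1+1}(2^k-2)\bigr]^{\frac{\delta+k-1}{\delta-2\alpha_1-\beta_1+1}}\Bigl(\frac{2(2\alpha_1+\beta_1+k-2)}{\delta+k-1}\Bigr)^{\frac{2\alpha_1+\beta_1+k-2}{\delta-2\alpha_1-\beta_1+1}}.$$ "The solution" with initial datum $f_0$ means the global classical solution $f\in C^1([0,\infty);\ell^1(\mathbb{N}))$ of $\frac{\partial f}{\partial t}=O[f]$, $f(0)=f_0$, which for all $t\ge0$ satisfies $f(t,i)\ge0$, $m_1\langle f(t)\rangle\le m_1\langle f_0\rangle$ and $m_\kappa\langle f(t)\rangle\le\max\{m_\kappa\langle f_0\rangle,2\mathcal{B}_\kappa(m_1\langle f_0\rangle)\}$ (the paper's well-posedness theorem gives existence and uniqueness). *)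

theory Defs
  imports "HOL-Analysis.Analysis"
begin

text \<open>
  Sequences indexed by the positive integers are functions of type \<^typ>\<open>nat \<Rightarrow> real\<close> whose
  value at \<open>0\<close> is never used: every sum and every quantifier below ranges over indices \<open>\<ge> 1\<close>.
  The exponents \<open>\<alpha> n\<close>, \<open>\<beta> n\<close> are only used for \<open>n \<in> {1,2,3}\<close>.
\<close>

definition kern :: "(nat \<Rightarrow> real) \<Rightarrow> (nat \<Rightarrow> real) \<Rightarrow> nat \<Rightarrow> real \<Rightarrow> real \<Rightarrow> real" where
  "kern \<alpha> \<beta> n x y = x powr \<alpha> n * y powr \<alpha> n * (x + y) powr \<beta> n"

definition S_coag ::
  "real \<Rightarrow> (nat \<Rightarrow> real) \<Rightarrow> (nat \<Rightarrow> real) \<Rightarrow> (nat \<Rightarrow> real) \<Rightarrow> nat \<Rightarrow> real" where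
  "S_coag h \<alpha> \<beta> f i =
     (\<Sum>j=1..<i. kern \<alpha> \<beta> 1 (real j * h) (real (i - j) * h) * f j * f (i - j))
     - 2 * (\<Sum>\<^sub>\<infinity>j\<in>{1..}. kern \<alpha> \<beta> 1 (real i * h) (real j * h) * f i * f j)"

text \<open>The operator \<open>S\<^sup>(\<^sup>n\<^sup>)\<close>, used for \<open>n = 2\<close> and \<open>n = 3\<close>.\<close>

definition S_diff ::
  "real \<Rightarrow> (nat \<Rightarrow> real) \<Rightarrow> (nat \<Rightarrow> real) \<Rightarrow> nat \<Rightarrow> (nat \<Rightarrow> real) \<Rightarrow> nat \<Rightarrow> real" where
  "S_diff h \<alpha> \<beta> n f i =
     - (\<Sum>j=1..<i. kern \<alpha> \<beta> n (real (i - j) * h) (real j * h) * f i * f j)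
     + (\<Sum>\<^sub>\<infinity>j\<in>{i+1..}. kern \<alpha> \<beta> n (real (j - i) * h) (real i * h) * f i * f j)
     + (\<Sum>\<^sub>\<infinity>j\<in>{i+1..}. kern \<alpha> \<beta> n (real i * h) (real (j - i) * h) * f j * f (j - i))"

definition V_op :: "real \<Rightarrow> real \<Rightarrow> (nat \<Rightarrow> real) \<Rightarrow> nat \<Rightarrow> real" where
  "V_op h \<delta> f i = (real i * h) powr \<delta> * f i"

definition O_op ::
  "real \<Rightarrow> (nat \<Rightarrow> real) \<Rightarrow> (nat \<Rightarrow> real) \<Rightarrow> real \<Rightarrow> (nat \<Rightarrow> real) \<Rightarrow> nat \<Rightarrow> real" where
  "O_op h \<alpha> \<beta> \<delta> f i =
     S_coag h \<alpha> \<beta> f i + S_diff h \<alpha> \<beta> 2 f i + S_diff h \<alpha> \<beta> 3 f i - V_op h \<delta> f i"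

text \<open>
  \<open>moment\<close> is real-valued, and \<^const>\<open>infsum\<close> is \<open>0\<close> on non-summable families, so finiteness
  of a moment has to be stated separately by \<open>finite_moment\<close>.
\<close>

definition finite_moment :: "real \<Rightarrow> real \<Rightarrow> (nat \<Rightarrow> real) \<Rightarrow> bool" where
  "finite_moment h k f \<longleftrightarrow> (\<lambda>i. f i * (real i * h) powr k) summable_on {1..}"

definition moment :: "real \<Rightarrow> real \<Rightarrow> (nat \<Rightarrow> real) \<Rightarrow> real" where
  "moment h k f = (\<Sum>\<^sub>\<infinity>i\<in>{1..}. f i * (real i * h) powr k)"

definition C_const :: "(nat \<Rightarrow> real) \<Rightarrow> (nat \<Rightarrow> real) \<Rightarrow> real \<Rightarrow> real \<Rightarrow> real" where
  "C_const \<alpha> \<beta> \<delta> k =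
     (\<delta> - 2 * \<alpha> 1 - \<beta> 1 + 1) / (\<delta> + k - 1)
     * (2 powr (\<beta> 1 + 1) * (2 powr k - 2)) powr ((\<delta> + k - 1) / (\<delta> - 2 * \<alpha> 1 - \<beta> 1 + 1))
     * (2 * (2 * \<alpha> 1 + \<beta> 1 + k - 2) / (\<delta> + k - 1))
         powr ((2 * \<alpha> 1 + \<beta> 1 + k - 2) / (\<delta> - 2 * \<alpha> 1 - \<beta> 1 + 1))"

definition B_fun :: "(nat \<Rightarrow> real) \<Rightarrow> (nat \<Rightarrow> real) \<Rightarrow> real \<Rightarrow> real \<Rightarrow> real \<Rightarrow> real" where
  "B_fun \<alpha> \<beta> \<delta> k x =
     (2 * C_const \<alpha> \<beta> \<delta> k
        * x powr (1 + (\<delta> + k - 1) / (\<delta> - 2 * \<alpha> 1 - \<beta> 1 + 1) + \<delta> / (k - 1)))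
     powr ((k - 1) / (\<delta> + k - 1))"

definition in_l1 :: "(nat \<Rightarrow> real) \<Rightarrow> bool" where
  "in_l1 g \<longleftrightarrow> (\<lambda>i. \<bar>g i\<bar>) summable_on {1..}"

definition l1_norm :: "(nat \<Rightarrow> real) \<Rightarrow> real" where
  "l1_norm g = (\<Sum>\<^sub>\<infinity>i\<in>{1..}. \<bar>g i\<bar>)"

text \<open>
  \<open>f\<close> belongs to \<open>C\<^sup>1([0,\<infinity>); \<ell>\<^sup>1)\<close> with derivative \<open>f'\<close>: the difference quotients converge to
  \<open>f'\<close> in the \<open>\<ell>\<^sup>1\<close> norm (one-sidedly at \<open>t = 0\<close>), and \<open>f'\<close> is continuous in that norm.
\<close>

definition C1_l1 :: "(real \<Rightarrow> nat \<Rightarrow> real) \<Rightarrow> (real \<Rightarrow> nat \<Rightarrow> real) \<Rightarrow> bool" where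
  "C1_l1 f f' \<longleftrightarrow>
     (\<forall>t\<ge>0. in_l1 (f t) \<and> in_l1 (f' t)
        \<and> ((\<lambda>s. l1_norm (\<lambda>i. (f s i - f t i) / (s - t) - f' t i)) \<longlongrightarrow> 0) (at t within {0..})
        \<and> ((\<lambda>s. l1_norm (\<lambda>i. f' s i - f' t i)) \<longlongrightarrow> 0) (at t within {0..}))"

definition classical_solution ::
  "real \<Rightarrow> (nat \<Rightarrow> real) \<Rightarrow> (nat \<Rightarrow> real) \<Rightarrow> real \<Rightarrow> (nat \<Rightarrow> real) \<Rightarrow> (real \<Rightarrow> nat \<Rightarrow> real) \<Rightarrow> bool" where
  "classical_solution h \<alpha> \<beta> \<delta> f0 f \<longleftrightarrow>
     C1_l1 f (\<lambda>t. O_op h \<alpha> \<beta> \<delta> (f t)) \<and> (\<forall>i\<ge>1. f 0 i = f0 i)"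

text \<open>
  The solution furnished by the well-posedness theory. The series in \<^const>\<open>O_op\<close> converge for
  such \<open>f\<close>: \<open>f t\<close> is nonnegative with a finite moment of order \<open>\<kappa> > \<delta> > \<alpha> n + \<beta> n\<close>.
\<close>

definition is_solution ::
  "real \<Rightarrow> (nat \<Rightarrow> real) \<Rightarrow> (nat \<Rightarrow> real) \<Rightarrow> real \<Rightarrow> real \<Rightarrow> (nat \<Rightarrow> real) \<Rightarrow> (real \<Rightarrow> nat \<Rightarrow> real) \<Rightarrow> bool"
  where
  "is_solution h \<alpha> \<beta> \<delta> \<kappa> f0 f \<longleftrightarrow>
     classical_solution h \<alpha> \<beta> \<delta> f0 f
     \<and> (\<forall>t\<ge>0. (\<forall>i\<ge>1. 0 \<le> f t i)
          \<and> finite_moment h 1 (f t) \<and> moment h 1 (f t) \<le> moment h 1 f0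
          \<and> finite_moment h \<kappa> (f t)
          \<and> moment h \<kappa> (f t) \<le> max (moment h \<kappa> f0) (2 * B_fun \<alpha> \<beta> \<delta> \<kappa> (moment h 1 f0)))"

end

theory Submission
  imports Defs
begin

text \<open>
  The idea is to test the equation with the bounded weights \<open>g i = min (i h) (N h) powr k\<close>, for which the
  weak formulation holds without knowing that the moment of order \<open>k\<close> is finite. Write
  \<open>P = \<Sum> g i (i h) powr \<delta> f i\<close> for the dissipation. Coagulation contributes only where both
  particles are below the cutoff; there Hoelder's inequality bounds it by a constant times
  \<open>m\<^sub>1 powr (2 - \<theta>) * P powr \<theta>\<close> with \<open>\<theta> < 1\<close>. The terms \<open>S\<^sup>(\<^sup>2\<^sup>)\<close> and \<open>S\<^sup>(\<^sup>3\<^sup>)\<close> contribute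
  nonpositively below the cutoff, where \<open>g\<close> is superadditive, and at most a small multiple of \<open>P\<close> above it,
  since \<open>\<delta> > \<alpha> n + \<beta> n\<close>. As \<open>P\<close> is bounded below by interpolation between the first and the truncated
  moment, the truncated moment cannot increase while it exceeds \<open>2 * B_fun\<close>, for all large \<open>N\<close>.

  The Povzner-type inequality behind the constant \<open>2 powr k - 2\<close> fails for \<open>k < 2\<close>; the loss is a factor
  \<open>2 powr (s / (k - 1))\<close> with \<open>s = max 0 (1 - \<alpha> 1)\<close>, and the factor 2 in front of \<open>B_fun\<close> absorbs it
  because \<open>s < \<delta> - 2 * \<alpha> 1 - \<beta> 1 + 1\<close>.
\<close>

section \<open>Inequalities for real powers\<close>

text \<open>Adding \<open>ln z \<ge> 1 - 1 / z\<close> at \<open>z = 2 * (1 - \<theta>)\<close> and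
  \<open>z = 2 * \<theta>\<close> with weights \<open>1 - \<theta>\<close> and
  \<open>\<theta>\<close> makes the right-hand sides cancel. In logarithmic form this is the bound
  \<open>ln 2\<close> on the entropy of a two-point distribution.\<close>

lemma entropy_le_ln2:
  fixes \<theta> :: real
  assumes "0 < \<theta>" "\<theta> < 1"
  shows "1 \<le> (2 * (1 - \<theta>)) powr (1 - \<theta>) * (2 * \<theta>) powr \<theta>"
proof -
  have ln_ge: "ln z \<ge> 1 - 1 / z" if "z > 0" for z :: real
    using ln_le_minus_one[of "1 / z"] that by (simp add: ln_div)
  have "(1 - \<theta>) * (1 - 1 / (2 * (1 - \<theta>))) \<le> (1 - \<theta>) * ln (2 * (1 - \<theta>))"
    using assms by (intro mult_left_mono ln_ge) auto
  moreover have "\<theta> * (1 - 1 / (2 * \<theta>)) \<le> \<theta> * ln (2 * \<theta>)"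
    using assms by (intro mult_left_mono ln_ge) auto
  moreover have "(1 - \<theta>) * (1 - 1 / (2 * (1 - \<theta>))) + \<theta> * (1 - 1 / (2 * \<theta>)) = 0"
    using assms by (simp add: field_simps)
  ultimately have "0 \<le> (1 - \<theta>) * ln (2 * (1 - \<theta>)) + \<theta> * ln (2 * \<theta>)"
    by linarith
  then have "1 \<le> exp ((1 - \<theta>) * ln (2 * (1 - \<theta>)) + \<theta> * ln (2 * \<theta>))"
    by simp
  then show ?thesis
    using assms by (simp add: powr_def exp_add mult.commute)
qed

lemma two_less_two_powr:
  fixes k :: real
  assumes "1 < k"
  shows "2 < 2 powr k"
proof -
  have "2 powr 1 < 2 powr k"
    using assms by (subst powr_less_cancel_iff) auto
  then show ?thesis by simp
qed

lemma powr_superadditive: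
  fixes x y k :: real
  assumes "1 \<le> k" "0 < x" "0 < y"
  shows "x powr k + y powr k \<le> (x + y) powr k"
proof -
  have "x powr k + y powr k = x * x powr (k - 1) + y * y powr (k - 1)"
    using assms by (simp add: powr_mult_base)
  also have "\<dots> \<le> x * (x + y) powr (k - 1) + y * (x + y) powr (k - 1)"
    using assms by (intro add_mono mult_left_mono powr_mono2) auto
  also have "\<dots> = (x + y) powr k"
    using assms by (simp add: powr_mult_base flip: distrib_right)
  finally show ?thesis .
qed

text \<open>As \<open>k > 1\<close>, the derivative of \<open>(1 + r) powr k - r powr k\<close> is
  nonnegative, so the worst case is \<open>r = 1\<close>.\<close>

lemma powr_defect_le_unit:
  fixes k r :: real
  assumes "1 < k" "0 < r" "r \<le> 1"
  shows "(1 + r) powr k - 1 - r powr k \<le> 2 powr k - 2"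
proof -
  define \<phi> where "\<phi> r = (1 + r) powr k - r powr k" for r :: real
  have "\<phi> r \<le> \<phi> 1"
  proof (rule DERIV_nonneg_imp_nondecreasing[OF assms(3)])
    fix z assume z: "r \<le> z" "z \<le> 1"
    have "(\<phi> has_real_derivative k * (1 + z) powr (k - 1) - k * z powr (k - 1)) (at z)"
      unfolding \<phi>_def using z assms by (auto intro!: derivative_eq_intros)
    moreover have "k * z powr (k - 1) \<le> k * (1 + z) powr (k - 1)"
      using z assms by (intro mult_left_mono powr_mono2) auto
    ultimately show "\<exists>d. (\<phi> has_real_derivative d) (at z) \<and> 0 \<le> d"
      by force
  qed
  then show ?thesis
    by (simp add: \<phi>_def)
qed

text \<open>The chord of the convex function \<open>x powr k\<close> over the interval from 1 to 2
  gives the bound; the term \<open>r powr k\<close> is simply dropped. This complements the constant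
  bound when \<open>r\<close> is small.\<close>

lemma powr_defect_le_linear:
  fixes k r :: real
  assumes "1 < k" "0 < r" "r \<le> 1"
  shows "(1 + r) powr k - 1 - r powr k \<le> (2 powr k - 1) * r"
proof -
  have "convex_on {0<..} (\<lambda>x::real. x powr k)"
    by (rule powr_convex) (use assms in auto) 
  then have "((1 - r) *\<^sub>R 1 + r *\<^sub>R 2) powr k \<le> (1 - r) * 1 powr k + r * 2 powr k"
    by (rule convex_onD) (use assms in auto)
  then have "(1 + r) powr k \<le> 1 - r + r * 2 powr k"
    by (simp add: algebra_simps)
  moreover have "(2 powr k - 1) * r = r * 2 powr k - r"
    by (simp add: algebra_simps)
  ultimately show ?thesis
    using powr_ge_zero[of r k] by linarith
qed

text \<open>With \<open>u = k - 1\<close> the claim becomes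
  \<open>(2 powr u - 1) * (2 powr (1 / u) - 1) \<ge> 1 / 2\<close>. One of \<open>u\<close> and
  \<open>1 / u\<close> is at least 1 and satisfies \<open>2 powr x \<ge> 1 + x\<close>; the tangent
  at 0 serves for the other. The product of the two lower bounds is \<open>ln 2\<close>.\<close>

lemma two_powr_minus_one_le:
  fixes k :: real
  assumes "1 < k"
  shows "2 powr k - 1 \<le> (2 powr k - 2) * 2 powr (1 / (k - 1))"
proof -
  define u where "u = k - 1"
  have u: "u > 0" using assms by (simp add: u_def)
  have ln2: "ln (2::real) \<ge> 1 / 2"
    using ln_le_minus_one[of "1 / 2 :: real"] by (simp add: ln_div)
  have exp_ge: "2 powr x \<ge> 1 + x * ln 2" for x :: real
    using exp_ge_add_one_self[of "x * ln 2"] by (simp add: powr_def)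
  have bern: "2 powr x \<ge> 1 + x" if "x \<ge> 1" for x :: real
  proof -
    have "2 powr x = 2 * 2 powr (x - 1)"
      by (simp add: powr_mult_base)
    also have "\<dots> \<ge> 2 * (1 + (x - 1) * ln 2)"
      using exp_ge[of "x - 1"] by simp
    moreover have "(x - 1) * (1 / 2) \<le> (x - 1) * ln 2"
      using that ln2 by (intro mult_left_mono) auto
    ultimately show ?thesis by simp
  qed
  have "1 / 2 \<le> (2 powr u - 1) * (2 powr (1 / u) - 1)"
  proof (cases "u \<ge> 1")
    case True
    have "1 / 2 \<le> u * (1 / u * ln 2)"
      using u ln2 by simp
    also have "\<dots> \<le> (2 powr u - 1) * (2 powr (1 / u) - 1)"
      using bern[OF True] exp_ge[of "1 / u"] u by (intro mult_mono) auto
    finally show ?thesis .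
  next
    case False
    then have "1 / u \<ge> 1" using u by simp
    have "1 / 2 \<le> (u * ln 2) * (1 / u)"
      using u ln2 by simp
    also have "\<dots> \<le> (2 powr u - 1) * (2 powr (1 / u) - 1)"
    proof (rule mult_mono)
      show "u * ln 2 \<le> 2 powr u - 1"
        using exp_ge[of u] by simp
      show "1 / u \<le> 2 powr (1 / u) - 1"
        using bern[OF \<open>1 / u \<ge> 1\<close>] by linarith
      show "0 \<le> 2 powr u - 1"
        using u ge_one_powr_ge_zero[of 2 u] by simp
    qed (use u in auto)
    finally show ?thesis .
  qed
  moreover have "2 powr k = 2 * 2 powr u"
    by (simp add: u_def powr_mult_base)
  ultimately show ?thesis
    by (simp add: algebra_simps flip: u_def)
qed

text \<open>
  Without the factor \<open>2 powr (s / (k - 1))\<close> this fails for \<open>1 < k < 2\<close> and \<open>s\<close> close to 1.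
\<close>
lemma powr_defect_le:
  fixes x y s k :: real
  assumes "1 < k" "0 < y" "y \<le> x" "0 \<le> s" "s \<le> 1"
  shows "(x + y) powr k - x powr k - y powr k
           \<le> (2 powr k - 2) * 2 powr (s / (k - 1)) * x powr (k - s) * y powr s"
proof -
  define r where "r = y / x"
  have r: "0 < r" "r \<le> 1" and y: "y = x * r" and x: "x > 0"
    using assms by (auto simp: r_def)
  define D where "D = 2 powr k - 2"
  have D: "D > 0" using two_less_two_powr[of k] assms by (simp add: D_def)
  \<comment> \<open>\<open>E\<close> is chosen so that the linear bound on \<open>\<phi>\<close>
    reads \<open>D * E\<close>. With the constant bound \<open>D\<close> this gives
    \<open>D * min 1 E\<close>, and \<open>min 1 E \<le> E powr s\<close> interpolates between the
    two for \<open>s\<close> in [0, 1].\<close>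
  define E where "E = 2 powr (1 / (k - 1)) * r"
  have E: "E > 0" using r by (simp add: E_def)
  define \<phi> where "\<phi> = (1 + r) powr k - 1 - r powr k"
  have "\<phi> \<le> (2 powr k - 1) * r"
    unfolding \<phi>_def by (rule powr_defect_le_linear) (use r assms in auto)
  also have "\<dots> \<le> (2 powr k - 2) * 2 powr (1 / (k - 1)) * r"
    using two_powr_minus_one_le[OF assms(1)] r by (intro mult_right_mono) auto
  finally have "\<phi> \<le> D * E"
    by (simp add: D_def E_def mult_ac)
  moreover have "\<phi> \<le> D"
    unfolding \<phi>_def D_def by (rule powr_defect_le_unit) (use r assms in auto)
  ultimately have "\<phi> \<le> D * min 1 E"
    by (simp add: min_def)
  also have "\<dots> \<le> D * E powr s"
  proof (intro mult_left_mono)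
    show "min 1 E \<le> E powr s"
    proof (cases "E \<ge> 1")
      case True
      then show ?thesis using assms by (simp add: ge_one_powr_ge_zero)
    next
      case False
      then have "E powr 1 \<le> E powr s"
        using E assms by (intro powr_mono') auto
      then show ?thesis using E by simp
    qed
  qed (use D in auto)
  also have "E powr s = 2 powr (s / (k - 1)) * r powr s"
    using r by (simp add: E_def powr_mult powr_powr)
  finally have "x powr k * \<phi> \<le> x powr k * (D * (2 powr (s / (k - 1)) * r powr s))"
    by (intro mult_left_mono) auto
  moreover have "x powr k * \<phi> = (x + y) powr k - x powr k - y powr k"
  proof -
    have "(x + y) powr k = (x * (1 + r)) powr k" by (simp add: y distrib_left)
    also have "\<dots> = x powr k * (1 + r) powr k"
      using r x by (simp add: powr_mult)
    finally show ?thesis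
      using r x unfolding \<phi>_def by (simp add: y powr_mult right_diff_distrib)
  qed
  moreover have "x powr k = x powr (k - s) * x powr s"
    by (simp flip: powr_add)
  then have "x powr k * r powr s = x powr (k - s) * y powr s"
    using r x by (simp add: y powr_mult)
  then have "x powr k * (D * (2 powr (s / (k - 1)) * r powr s))
      = D * 2 powr (s / (k - 1)) * x powr (k - s) * y powr s"
    by (simp add: mult_ac)
  ultimately show ?thesis
    unfolding D_def by linarith
qed

section \<open>Hoelder's inequality for series and a barrier principle\<close>

text \<open>Young's inequality is applied termwise after dividing \<open>u\<close> and
  \<open>v\<close> by their sums; the cases of a vanishing sum are separate because of this
  division.\<close>

lemma infsum_Holder:
  fixes u v :: "'a \<Rightarrow> real"
  assumes "u summable_on A" "v summable_on A"
    and u0: "\<And>i. i \<in> A \<Longrightarrow> 0 \<le> u i" and v0: "\<And>i. i \<in> A \<Longrightarrow> 0 \<le> v i"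
    and \<theta>: "0 \<le> \<theta>" "\<theta> \<le> 1"
  shows "(\<Sum>\<^sub>\<infinity>i\<in>A. u i powr (1 - \<theta>) * v i powr \<theta>)
           \<le> (\<Sum>\<^sub>\<infinity>i\<in>A. u i) powr (1 - \<theta>) * (\<Sum>\<^sub>\<infinity>i\<in>A. v i) powr \<theta>"
proof -
  define U V where "U = (\<Sum>\<^sub>\<infinity>i\<in>A. u i)" and "V = (\<Sum>\<^sub>\<infinity>i\<in>A. v i)"
  have nn: "U \<ge> 0" "V \<ge> 0"
    using u0 v0 by (auto simp: U_def V_def intro: infsum_nonneg)
  consider "U = 0" | "V = 0" | "U > 0" "V > 0"
    using nn by linarith
  then show ?thesis
  proof cases
    case 1
    have "u i = 0" if "i \<in> A" for i
      by (rule nonneg_infsum_le_0D[of u A]) (use 1 that assms in \<open>auto simp: U_def\<close>)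
    \<comment> \<open>\<open>0 powr x\<close> is 0 for every \<open>x\<close>, also for
      \<open>x = 0\<close>, so the summands vanish even at the endpoint
      \<open>\<theta> = 1\<close>.\<close>
    then have "(\<Sum>\<^sub>\<infinity>i\<in>A. u i powr (1 - \<theta>) * v i powr \<theta>) = 0"
      by (intro infsum_0) auto
    then show ?thesis by simp
  next
    case 2
    have "v i = 0" if "i \<in> A" for i
      by (rule nonneg_infsum_le_0D[of v A]) (use 2 that assms in \<open>auto simp: V_def\<close>)
    then have "(\<Sum>\<^sub>\<infinity>i\<in>A. u i powr (1 - \<theta>) * v i powr \<theta>) = 0"
      by (intro infsum_0) auto
    then show ?thesis by simp
  next
    case 3
    define W where "W = U powr (1 - \<theta>) * V powr \<theta>"
    \<comment> \<open>The majorant from Young's inequality, scaled back by \<open>W\<close>; its sum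
      is exactly \<open>W\<close>, because the weights \<open>1 - \<theta>\<close> and
      \<open>\<theta>\<close> add up to 1.\<close>
    define b where "b i = W * ((1 - \<theta>) * (u i / U) + \<theta> * (v i / V))" for i
    have W: "W > 0" using 3 by (simp add: W_def)
    have le: "u i powr (1 - \<theta>) * v i powr \<theta> \<le> b i" if "i \<in> A" for i
    proof (cases "u i = 0 \<or> v i = 0")
      case True
      then show ?thesis
        using W 3 \<theta> u0[OF that] v0[OF that] by (auto simp: b_def)
    next
      case False
      then have pos: "u i > 0" "v i > 0"
        using u0[OF that] v0[OF that] by auto
      have "(u i / U) powr (1 - \<theta>) * (v i / V) powr \<theta> \<le> (1 - \<theta>) * (u i / U) + \<theta> * (v i / V)"
        by (rule Youngs_inequality_0) (use 3 pos \<theta> in auto)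
      then have "W * ((u i / U) powr (1 - \<theta>) * (v i / V) powr \<theta>) \<le> b i"
        unfolding b_def using W by (intro mult_left_mono) auto
      moreover have "W * ((u i / U) powr (1 - \<theta>) * (v i / V) powr \<theta>)
          = u i powr (1 - \<theta>) * v i powr \<theta>"
        using 3 pos by (simp add: W_def powr_divide)
      ultimately show ?thesis by simp
    qed
    have bs: "(b has_sum (W * ((1 - \<theta>) * (U / U) + \<theta> * (V / V)))) A"
      unfolding b_def divide_inverse
      by (intro has_sum_cmult_right has_sum_add has_sum_cmult_left)
         (use assms in \<open>auto simp: U_def V_def\<close>)
    then have bW: "infsum b A = W"
      using 3 by (simp add: infsumI)
    have "(\<Sum>\<^sub>\<infinity>i\<in>A. u i powr (1 - \<theta>) * v i powr \<theta>) \<le> infsum b A"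
    proof (rule infsum_mono)
      show "b summable_on A" using bs by (auto simp: summable_on_def)
      then show "(\<lambda>i. u i powr (1 - \<theta>) * v i powr \<theta>) summable_on A"
        by (rule summable_on_comparison_test) (use le in auto)
    qed (use le in auto)
    then show ?thesis using bW by (simp add: W_def U_def V_def)
  qed
qed

text \<open>After the last time at which \<open>u\<close> is at most \<open>max (u 0) B\<close>, the
  function stays above \<open>B\<close> and hence cannot increase, so it never gets above that
  level. The derivative is one-sided at 0, which suits an evolution equation started there.\<close>

lemma barrier:
  fixes u u' :: "real \<Rightarrow> real"
  assumes deriv: "\<And>t. 0 \<le> t \<Longrightarrow> (u has_real_derivative u' t) (at t within {0..})"
    and nonpos: "\<And>t. 0 \<le> t \<Longrightarrow> B < u t \<Longrightarrow> u' t \<le> 0"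
    and "0 \<le> t"
  shows "u t \<le> max (u 0) B"
proof (rule ccontr)
  define m where "m = max (u 0) B"
  assume "\<not> u t \<le> max (u 0) B"
  then have ut: "m < u t" by (simp only: m_def not_le)
  define S where "S = {s \<in> {0..t}. u s \<le> m}"
  have cont: "continuous_on {0..t} u"
  proof (rule continuous_on_subset)
    show "continuous_on {0..} u"
      using deriv by (intro DERIV_continuous_on[where D = u']) simp
  qed simp
  have "closed S"
  proof -
    have "closed {s \<in> {0..t}. u s \<le> m}"
      by (intro continuous_on_closed_Collect_le cont continuous_on_const) auto
    then show ?thesis by (simp add: S_def)
  qed
  moreover have "bounded S"
    by (rule bounded_subset[of "{0..t}"]) (auto simp: S_def)
  ultimately have "compact S"
    by (simp add: compact_eq_bounded_closed)
  moreover have "0 \<in> S"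
    using assms(3) by (simp add: S_def m_def)
  \<comment> \<open>The last time in [0, t] at which the level is not exceeded; it exists by
    compactness.\<close>
  ultimately obtain s where s: "s \<in> S" "\<And>r. r \<in> S \<Longrightarrow> r \<le> s"
    using compact_attains_sup[of S] by auto
  then have s0: "0 \<le> s" "s < t" "u s \<le> m"
    using ut unfolding S_def by (auto intro: le_neq_trans)
  have "u t \<le> u s"
  proof (rule DERIV_nonpos_imp_decreasing_open[where f = u])
    show "\<exists>y. (u has_real_derivative y) (at x) \<and> y \<le> 0" if x: "s < x" "x < t" for x
    proof -
      have "u x > m"
      proof (rule ccontr)
        assume "\<not> m < u x"
        then have "x \<in> S"
          using x s0 by (simp add: S_def)
        then show False
          using s(2) x by fastforce
      qed
      then have "u' x \<le> 0"
        using nonpos[of x] x s0 by (simp add: m_def)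
      moreover have "at x within {0..} = at x"
        using x s0 by (intro at_within_interior) auto
      ultimately show ?thesis
        using deriv[of x] x s0 by auto
    qed
    show "continuous_on {s..t} u"
      by (rule continuous_on_subset[OF cont]) (use s0 in auto)
  qed (use s0 in auto)
  then show False
    using s0 ut by simp
qed

section \<open>Weak formulation\<close>

abbreviation pairs :: "(nat \<times> nat) set" where
  "pairs \<equiv> {1..} \<times> {1..}"

lemma has_sum_rows:
  fixes F :: "nat \<times> nat \<Rightarrow> real"
  assumes "(F has_sum S) pairs"
  shows "((\<lambda>i. \<Sum>\<^sub>\<infinity>j\<in>{1..}. F (i, j)) has_sum S) {1..}"
proof (rule has_sum_SigmaD[OF assms])
  fix i :: nat assume "i \<in> {1..}"
  moreover have "(\<lambda>(x, y). F (x, y)) summable_on pairs"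
    using has_sum_imp_summable[OF assms] by (simp add: case_prod_unfold)
  ultimately have "(\<lambda>j. F (i, j)) summable_on {1..}"
    by (rule summable_on_SigmaD1[rotated])
  then show "((\<lambda>j. F (i, j)) has_sum (\<Sum>\<^sub>\<infinity>j\<in>{1..}. F (i, j))) {1..}"
    by simp
qed

lemma infsum_greater_eq_shift:
  fixes F :: "nat \<Rightarrow> nat \<Rightarrow> real"
  shows "(\<Sum>\<^sub>\<infinity>j\<in>{i+1..}. F (j - i) j) = (\<Sum>\<^sub>\<infinity>a\<in>{1..}. F a (a + i))"
  by (rule infsum_reindex_bij_witness[of _ "\<lambda>a. a + i" "\<lambda>j. j - i"]) auto

text \<open>The map from \<open>(a, b)\<close> to \<open>(a + b, b)\<close> is a bijection from
  \<open>pairs\<close> onto the index pairs \<open>(i, j)\<close> with \<open>1 \<le> j < i\<close>.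
  It turns the finite inner sums of the collision operators into sums over
  \<open>pairs\<close>.\<close>

lemma has_sum_antidiagonals:
  fixes F :: "nat \<times> nat \<Rightarrow> real"
  assumes "(F has_sum S) pairs"
  shows "((\<lambda>i. \<Sum>j=1..<i. F (i - j, j)) has_sum S) {1..}"
proof (rule has_sum_SigmaD[where f = "\<lambda>(i, j). F (i - j, j)"])
  have "((\<lambda>(i, j). F (i - j, j)) has_sum S) (Sigma {1..} (\<lambda>i. {1..<i})) \<longleftrightarrow> (F has_sum S) pairs"
    by (rule has_sum_reindex_bij_witness[of _ "\<lambda>(a, b). (a + b, b)" "\<lambda>(i, j). (i - j, j)"]) auto
  then show "((\<lambda>(i, j). F (i - j, j)) has_sum S) (Sigma {1..} (\<lambda>i. {1..<i}))"
    using assms by simp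
qed auto

lemma has_sum_times:
  fixes u v :: "nat \<Rightarrow> real"
  assumes "u summable_on {1..}" "v summable_on {1..}"
    and "\<And>i. i \<ge> 1 \<Longrightarrow> 0 \<le> u i" "\<And>i. i \<ge> 1 \<Longrightarrow> 0 \<le> v i"
  shows "((\<lambda>(a, b). u a * v b) has_sum (infsum u {1..} * infsum v {1..})) pairs"
proof -
  have f: "((\<lambda>b. case (a, b) of (a, b) \<Rightarrow> u a * v b) has_sum (u a * infsum v {1..})) {1..}" for a
    using assms(2) by (auto intro: has_sum_cmult_right)
  have g: "((\<lambda>a. u a * infsum v {1..}) has_sum (infsum u {1..} * infsum v {1..})) {1..}"
    using assms(1) by (auto intro: has_sum_cmult_left)
  show ?thesis
  proof (rule has_sum_SigmaI[OF f g])
    show "(\<lambda>(a, b). u a * v b) summable_on pairs"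
      by (rule summable_on_SigmaI[OF f has_sum_imp_summable[OF g]]) (use assms in auto)
  qed
qed

lemma summable_on_shear:
  fixes F :: "nat \<times> nat \<Rightarrow> real"
  assumes "F summable_on pairs"
  shows "(\<lambda>(a, b). F (a + b, b)) summable_on pairs"
proof -
  have "F summable_on (\<lambda>(a, b). (a + b, b)) ` pairs"
    using assms by (rule summable_on_subset_banach) auto
  moreover have "inj_on (\<lambda>(a, b). (a + b, b)) pairs"
    by (auto simp: inj_on_def)
  ultimately show ?thesis
    by (simp add: summable_on_reindex comp_def case_prod_unfold)
qed

text \<open>The shear is injective into \<open>pairs\<close>, so the left side is a sum of the
  nonnegative \<open>F\<close> over a subset. It decouples the factors at \<open>a + b\<close> and
  at \<open>b\<close>.\<close>

lemma infsum_shear_le: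
  fixes F :: "nat \<times> nat \<Rightarrow> real"
  assumes "F summable_on pairs" "\<And>p. p \<in> pairs \<Longrightarrow> 0 \<le> F p"
  shows "(\<Sum>\<^sub>\<infinity>(a, b)\<in>pairs. F (a + b, b)) \<le> infsum F pairs"
proof -
  have "inj_on (\<lambda>(a, b). (a + b, b)) pairs"
    by (auto simp: inj_on_def)
  then have "(\<Sum>\<^sub>\<infinity>(a, b)\<in>pairs. F (a + b, b)) = infsum F ((\<lambda>(a, b). (a + b, b)) ` pairs)"
    by (simp add: infsum_reindex comp_def case_prod_unfold)
  also have "\<dots> \<le> infsum F pairs"
    using assms by (intro infsum_mono_neutral summable_on_subset_banach[OF assms(1)]) auto
  finally show ?thesis .
qed

section \<open>Summability of the collision terms\<close>

lemma kern_nonneg: "0 \<le> kern \<alpha> \<beta> n x y"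
  by (simp add: kern_def)

lemma kern_commute: "kern \<alpha> \<beta> n x y = kern \<alpha> \<beta> n y x"
  by (simp add: kern_def add.commute mult.commute)

text \<open>All sizes \<open>real i * h\<close> are at least \<open>h\<close>, so the nonpositive
  power \<open>p - q\<close> of a size is at most \<open>h powr (p - q)\<close>.\<close>

lemma finite_moment_mono:
  assumes "h > 0" "p \<le> q" "\<forall>i\<ge>1. 0 \<le> f i" "finite_moment h q f"
  shows "finite_moment h p f" "moment h p f \<le> h powr (p - q) * moment h q f"
proof -
  have le: "f i * (real i * h) powr p \<le> h powr (p - q) * (f i * (real i * h) powr q)" if "i \<ge> 1" for i
  proof -
    have "(real i * h) powr (p - q) \<le> h powr (p - q)"
      using that assms by (intro powr_mono2') auto
    then have "(real i * h) powr (p - q) * (f i * (real i * h) powr q)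
        \<le> h powr (p - q) * (f i * (real i * h) powr q)"
      using assms that by (intro mult_right_mono) auto
    moreover have "(real i * h) powr p = (real i * h) powr (p - q) * (real i * h) powr q"
      by (simp flip: powr_add)
    ultimately show ?thesis by (simp add: mult_ac)
  qed
  have s: "(\<lambda>i. h powr (p - q) * (f i * (real i * h) powr q)) summable_on {1..}"
    using assms by (intro summable_on_cmult_right) (simp add: finite_moment_def)
  show fin: "finite_moment h p f"
    unfolding finite_moment_def
    by (rule summable_on_comparison_test[OF s]) (use le assms in auto)
  have "moment h p f \<le> (\<Sum>\<^sub>\<infinity>i\<in>{1..}. h powr (p - q) * (f i * (real i * h) powr q))"
    unfolding moment_def
    by (intro infsum_mono s fin[unfolded finite_moment_def]) (use le in auto)
  also have "\<dots> = h powr (p - q) * moment h q f"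
    unfolding moment_def by (rule infsum_cmult_right')
  finally show "moment h p f \<le> h powr (p - q) * moment h q f" .
qed

text \<open>Since both sizes are at least \<open>h\<close>,
  \<open>x + y \<le> 2 / h * (x * y)\<close>. This separates the variables in the factor
  \<open>(x + y) powr \<beta> n\<close> and leaves a product of two convergent series.\<close>

lemma summable_coag_pairs:
  assumes "h > 0" "\<beta> n > 0" "\<forall>i\<ge>1. 0 \<le> f i" "finite_moment h (\<alpha> n + \<beta> n) f"
  shows "(\<lambda>(a, b). kern \<alpha> \<beta> n (real a * h) (real b * h) * f a * f b) summable_on pairs"
proof -
  define w where "w i = f i * (real i * h) powr (\<alpha> n + \<beta> n)" for i
  have "(\<lambda>(a, b). w a * w b) summable_on pairs"
    by (rule has_sum_imp_summable[OF has_sum_times])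
       (use assms in \<open>auto simp: w_def finite_moment_def\<close>)
  then have "(\<lambda>p. (2 / h) powr \<beta> n * (case p of (a, b) \<Rightarrow> w a * w b)) summable_on pairs"
    by (rule summable_on_cmult_right)
  then show ?thesis
  proof (rule summable_on_comparison_test)
    fix p assume "p \<in> pairs"
    then obtain a b where p: "p = (a, b)" "a \<ge> 1" "b \<ge> 1" by auto
    define x y where "x = real a * h" and "y = real b * h"
    have xy: "x \<ge> h" "y \<ge> h" "x > 0" "y > 0"
      using p assms by (auto simp: x_def y_def)
    have "x * h \<le> x * y" "y * h \<le> y * x"
      using xy by (auto intro: mult_left_mono)
    then have "(x + y) * h \<le> 2 * (x * y)"
      by (simp add: algebra_simps)
    then have "x + y \<le> 2 / h * (x * y)"
      using assms(1) by (simp add: field_simps)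
    then have "(x + y) powr \<beta> n \<le> (2 / h * (x * y)) powr \<beta> n"
      using xy assms by (intro powr_mono2) auto
    also have "\<dots> = (2 / h) powr \<beta> n * (x powr \<beta> n * y powr \<beta> n)"
      using xy assms by (subst powr_mult) (auto simp: powr_mult)
    finally have "x powr \<alpha> n * y powr \<alpha> n * f a * f b * (x + y) powr \<beta> n
        \<le> x powr \<alpha> n * y powr \<alpha> n * f a * f b * ((2 / h) powr \<beta> n * (x powr \<beta> n * y powr \<beta> n))"
      using assms p by (intro mult_left_mono) auto
    then show "(case p of (a, b) \<Rightarrow> kern \<alpha> \<beta> n (real a * h) (real b * h) * f a * f b)
        \<le> (2 / h) powr \<beta> n * (case p of (a, b) \<Rightarrow> w a * w b)"
      unfolding p x_def y_def by (simp add: kern_def w_def powr_add mult_ac)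
  qed (use assms in \<open>auto simp: kern_nonneg\<close>)
qed

text \<open>Only the factor \<open>(real a * h) powr \<alpha> n\<close> has to be enlarged: with
  \<open>a + b\<close> in place of \<open>a\<close>, the term becomes a function of
  \<open>a + b\<close> times a function of \<open>b\<close>, to which the shear applies.\<close>

lemma diff_pairs_le:
  assumes "h > 0" "\<alpha> n > 0" "\<beta> n > 0" "\<forall>i\<ge>1. 0 \<le> f i" "1 \<le> a" "1 \<le> b"
  shows "kern \<alpha> \<beta> n (real a * h) (real b * h) * f (a + b) * f b
           \<le> (f (a + b) * (real (a + b) * h) powr (\<alpha> n + \<beta> n)) * (f b * (real b * h) powr \<alpha> n)"
proof -
  have "(real a * h) powr \<alpha> n \<le> (real (a + b) * h) powr \<alpha> n"
    using assms by (intro powr_mono2) auto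
  then have "((real b * h) powr \<alpha> n * (real (a + b) * h) powr \<beta> n * f (a + b) * f b) * (real a * h) powr \<alpha> n
      \<le> ((real b * h) powr \<alpha> n * (real (a + b) * h) powr \<beta> n * f (a + b) * f b) * (real (a + b) * h) powr \<alpha> n"
    using assms by (intro mult_left_mono) auto
  moreover have "real a * h + real b * h = real (a + b) * h"
    by (simp add: distrib_right)
  ultimately show ?thesis
    unfolding kern_def by (simp only: powr_add mult_ac)
qed

lemma summable_diff_pairs:
  assumes "h > 0" "\<alpha> n > 0" "\<beta> n > 0" "\<forall>i\<ge>1. 0 \<le> f i" "finite_moment h (\<alpha> n + \<beta> n) f"
  shows "(\<lambda>(a, b). kern \<alpha> \<beta> n (real a * h) (real b * h) * f (a + b) * f b) summable_on pairs"
proof -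
  define u v where "u i = f i * (real i * h) powr (\<alpha> n + \<beta> n)" 
    and "v i = f i * (real i * h) powr \<alpha> n" for i
  have "finite_moment h (\<alpha> n) f"
    by (rule finite_moment_mono[of h "\<alpha> n" "\<alpha> n + \<beta> n"]) (use assms in auto)
  then have "(\<lambda>(a, b). u a * v b) summable_on pairs"
    by (intro has_sum_imp_summable[OF has_sum_times])
       (use assms in \<open>auto simp: u_def v_def finite_moment_def\<close>)
  from summable_on_shear[OF this]
  have "(\<lambda>(a, b). u (a + b) * v b) summable_on pairs"
    by simp
  then show ?thesis
    by (rule summable_on_comparison_test)
       (use diff_pairs_le[of h \<alpha> n \<beta> f] assms in \<open>auto simp: kern_nonneg u_def v_def\<close>)
qed

lemma summable_on_mult_bounded:
  fixes F c :: "'a \<Rightarrow> real"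
  assumes "F summable_on A" "\<And>x. x \<in> A \<Longrightarrow> 0 \<le> F x" "\<And>x. x \<in> A \<Longrightarrow> \<bar>c x\<bar> \<le> G"
  shows "(\<lambda>x. F x * c x) summable_on A"
proof (rule abs_summable_summable)
  show "(\<lambda>x. norm (F x * c x)) summable_on A"
  proof (rule summable_on_comparison_test)
    show "(\<lambda>x. F x * G) summable_on A"
      using assms(1) by (rule summable_on_cmult_left)
    show "norm (F x * c x) \<le> F x * G" if "x \<in> A" for x
      using assms(2,3)[OF that] by (auto simp: abs_mult intro!: mult_left_mono)
  qed auto
qed

section \<open>Testing the equation with bounded weights\<close>

text \<open>For bounded \<open>g\<close> all double series converge absolutely, so the gain can be
  summed along antidiagonals and the loss along rows. Symmetry of the kernel splits the doubled loss
  evenly between \<open>g a\<close> and \<open>g b\<close>.\<close>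

lemma S_coag_weak:
  fixes f g :: "nat \<Rightarrow> real"
  assumes "(\<lambda>(a, b). kern \<alpha> \<beta> 1 (real a * h) (real b * h) * f a * f b) summable_on pairs"
    and f0: "\<forall>i\<ge>1. 0 \<le> f i" and g: "\<And>i. \<bar>g i\<bar> \<le> G"
  defines "T \<equiv> \<lambda>(a, b). kern \<alpha> \<beta> 1 (real a * h) (real b * h) * f a * f b
                          * (g (a + b) - g a - g b)"
  shows "T summable_on pairs"
    and "((\<lambda>i. g i * S_coag h \<alpha> \<beta> f i) has_sum infsum T pairs) {1..}"
proof -
  define K where "K a b = kern \<alpha> \<beta> 1 (real a * h) (real b * h) * f a * f b" for a b
  have K: "(\<lambda>p. K (fst p) (snd p)) summable_on pairs"
    using assms(1) by (simp add: K_def case_prod_unfold)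
  have sum: "(\<lambda>(a, b). K a b * c a b) summable_on pairs" if "\<And>a b. \<bar>c a b\<bar> \<le> G" for c
    unfolding case_prod_unfold
    by (rule summable_on_mult_bounded[OF K]) (use that f0 in \<open>auto simp: K_def kern_nonneg\<close>)
  define F1 F2 where "F1 = (\<lambda>(a, b). K a b * g (a + b))" and "F2 = (\<lambda>(a, b). K a b * g a)"
  have s1: "(F1 has_sum infsum F1 pairs) pairs" and s2: "(F2 has_sum infsum F2 pairs) pairs"
    using sum[of "\<lambda>a b. g (a + b)"] sum[of "\<lambda>a b. g a"] g by (auto simp: F1_def F2_def)
  have "K a b = K b a" for a b
    using kern_commute[of \<alpha> \<beta> 1 "real a * h" "real b * h"] by (simp add: K_def mult_ac)
  \<comment> \<open>The loss summed with the roles of the two particles exchanged; this supplies the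
    second of its two copies.\<close>
  then have "((\<lambda>(a, b). K a b * g b) has_sum infsum F2 pairs) pairs"
    using s2 by (subst has_sum_swap) (simp add: F2_def)
  from has_sum_add[OF s1 has_sum_uminusI[OF has_sum_add[OF s2 this]]]
  have T: "(T has_sum (infsum F1 pairs - 2 * infsum F2 pairs)) pairs"
    by (simp add: T_def F1_def F2_def K_def case_prod_unfold algebra_simps)
  then show "T summable_on pairs"
    by (rule has_sum_imp_summable)
  have "((\<lambda>i. (\<Sum>j=1..<i. F1 (i - j, j)) + - (2 * (\<Sum>\<^sub>\<infinity>j\<in>{1..}. F2 (i, j)))) has_sum
          (infsum F1 pairs + - (2 * infsum F2 pairs))) {1..}"
    by (intro has_sum_add has_sum_uminusI has_sum_cmult_right has_sum_antidiagonals has_sum_rows s1 s2)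
  moreover have "(\<Sum>j=1..<i. F1 (i - j, j)) + - (2 * (\<Sum>\<^sub>\<infinity>j\<in>{1..}. F2 (i, j)))
      = g i * S_coag h \<alpha> \<beta> f i" for i
  proof -
    have "(\<Sum>j=1..<i. F1 (i - j, j)) =
        g i * (\<Sum>j=1..<i. kern \<alpha> \<beta> 1 (real j * h) (real (i - j) * h) * f j * f (i - j))"
      unfolding sum_distrib_left
    proof (rule sum.cong)
      fix j assume "j \<in> {1..<i}"
      then show "F1 (i - j, j) = g i * (kern \<alpha> \<beta> 1 (real j * h) (real (i - j) * h) * f j * f (i - j))"
        using kern_commute[of \<alpha> \<beta> 1 "real j * h" "real (i - j) * h"]
        by (simp add: F1_def K_def mult_ac)
    qed auto
    moreover have "(\<Sum>\<^sub>\<infinity>j\<in>{1..}. F2 (i, j)) =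
        g i * (\<Sum>\<^sub>\<infinity>j\<in>{1..}. kern \<alpha> \<beta> 1 (real i * h) (real j * h) * f i * f j)"
      by (simp add: F2_def K_def mult_ac flip: infsum_cmult_right')
    ultimately show ?thesis
      by (simp add: S_coag_def algebra_simps)
  qed
  ultimately show "((\<lambda>i. g i * S_coag h \<alpha> \<beta> f i) has_sum infsum T pairs) {1..}"
    using infsumI[OF T] by simp
qed

text \<open>In an encounter of sizes \<open>a + b\<close> and \<open>b\<close> the larger particle
  is replaced by \<open>a\<close> and a further \<open>b\<close>. The three sums of
  \<open>S_diff\<close> collect these events by \<open>a + b\<close>, by \<open>b\<close> and by
  \<open>a\<close>, which explains the three regroupings \<open>F1\<close>, \<open>F2\<close>,
  \<open>F3\<close> of one double series.\<close>

lemma S_diff_weak: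
  fixes f g :: "nat \<Rightarrow> real"
  assumes "(\<lambda>(a, b). kern \<alpha> \<beta> n (real a * h) (real b * h) * f (a + b) * f b) summable_on pairs"
    and f0: "\<forall>i\<ge>1. 0 \<le> f i" and g: "\<And>i. \<bar>g i\<bar> \<le> G"
  defines "T \<equiv> \<lambda>(a, b). kern \<alpha> \<beta> n (real a * h) (real b * h) * f (a + b) * f b
                          * (g a + g b - g (a + b))"
  shows "T summable_on pairs"
    and "((\<lambda>i. g i * S_diff h \<alpha> \<beta> n f i) has_sum infsum T pairs) {1..}"
proof -
  define K where "K a b = kern \<alpha> \<beta> n (real a * h) (real b * h) * f (a + b) * f b" for a b
  have K: "(\<lambda>p. K (fst p) (snd p)) summable_on pairs"
    using assms(1) by (simp add: K_def case_prod_unfold)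
  have sum: "(\<lambda>(a, b). K a b * c a b) summable_on pairs" if "\<And>a b. \<bar>c a b\<bar> \<le> G" for c
    unfolding case_prod_unfold
    by (rule summable_on_mult_bounded[OF K]) (use that f0 in \<open>auto simp: K_def kern_nonneg\<close>)
  define F1 F2 F3 where "F1 = (\<lambda>(a, b). K a b * g (a + b))" 
    and "F2 = (\<lambda>(a, b). K a b * g b)" and "F3 = (\<lambda>(a, b). K a b * g a)"
  have s1: "(F1 has_sum infsum F1 pairs) pairs" and s2: "(F2 has_sum infsum F2 pairs) pairs"
    and s3: "(F3 has_sum infsum F3 pairs) pairs"
    using sum[of "\<lambda>a b. g (a + b)"] sum[of "\<lambda>a b. g a"] sum[of "\<lambda>a b. g b"] g
    by (auto simp: F1_def F2_def F3_def)
  from has_sum_add[OF has_sum_add[OF has_sum_uminusI[OF s1] s2] s3]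
  have T: "(T has_sum (- infsum F1 pairs + infsum F2 pairs + infsum F3 pairs)) pairs"
    by (simp add: T_def F1_def F2_def F3_def K_def case_prod_unfold algebra_simps)
  then show "T summable_on pairs"
    by (rule has_sum_imp_summable)
  have "((\<lambda>(i, a). F2 (a, i)) has_sum infsum F2 pairs) pairs"
    using s2 by (subst (asm) has_sum_swap)
  from has_sum_rows[OF this]
  have s2': "((\<lambda>i. \<Sum>\<^sub>\<infinity>a\<in>{1..}. F2 (a, i)) has_sum infsum F2 pairs) {1..}"
    by simp
  have "((\<lambda>i. - (\<Sum>j=1..<i. F1 (i - j, j)) + (\<Sum>\<^sub>\<infinity>a\<in>{1..}. F2 (a, i)) + (\<Sum>\<^sub>\<infinity>a\<in>{1..}. F3 (i, a)))
      has_sum (- infsum F1 pairs + infsum F2 pairs + infsum F3 pairs)) {1..}"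
    by (intro has_sum_add has_sum_uminusI has_sum_antidiagonals has_sum_rows s1 s2' s3)
  moreover have "- (\<Sum>j=1..<i. F1 (i - j, j)) + (\<Sum>\<^sub>\<infinity>a\<in>{1..}. F2 (a, i)) + (\<Sum>\<^sub>\<infinity>a\<in>{1..}. F3 (i, a))
      = g i * S_diff h \<alpha> \<beta> n f i" for i
  proof -
    have "(\<Sum>j=1..<i. F1 (i - j, j)) =
        g i * (\<Sum>j=1..<i. kern \<alpha> \<beta> n (real (i - j) * h) (real j * h) * f i * f j)"
      unfolding sum_distrib_left
      by (rule sum.cong) (auto simp: F1_def K_def mult_ac)
    moreover have "(\<Sum>\<^sub>\<infinity>a\<in>{1..}. F2 (a, i)) =
        g i * (\<Sum>\<^sub>\<infinity>j\<in>{i+1..}. kern \<alpha> \<beta> n (real (j - i) * h) (real i * h) * f i * f j)"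
      unfolding infsum_greater_eq_shift[of "\<lambda>a j. kern \<alpha> \<beta> n (real a * h) (real i * h) * f i * f j"]
      by (simp add: F2_def K_def mult_ac flip: infsum_cmult_right')
    moreover have "(\<Sum>\<^sub>\<infinity>a\<in>{1..}. F3 (i, a)) =
        g i * (\<Sum>\<^sub>\<infinity>j\<in>{i+1..}. kern \<alpha> \<beta> n (real i * h) (real (j - i) * h) * f j * f (j - i))"
      unfolding infsum_greater_eq_shift[of "\<lambda>a j. kern \<alpha> \<beta> n (real i * h) (real a * h) * f j * f a"]
      by (simp add: F3_def K_def mult_ac add.commute flip: infsum_cmult_right')
    ultimately show ?thesis
      by (simp add: S_diff_def algebra_simps)
  qed
  ultimately show "((\<lambda>i. g i * S_diff h \<alpha> \<beta> n f i) has_sum infsum T pairs) {1..}"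
    using infsumI[OF T] by simp
qed

text \<open>Pairing with \<open>g\<close> is a linear functional on summable sequences bounded by
  \<open>G\<close> times the norm, so it carries convergence of difference quotients in that norm
  over to real numbers.\<close>

lemma has_real_derivative_infsum_l1:
  fixes f f' :: "real \<Rightarrow> nat \<Rightarrow> real" and g :: "nat \<Rightarrow> real"
  assumes C1: "C1_l1 f f'" and g: "\<And>i. \<bar>g i\<bar> \<le> G" and "0 \<le> t"
  shows "((\<lambda>s. \<Sum>\<^sub>\<infinity>i\<in>{1..}. g i * f s i) has_real_derivative
            (\<Sum>\<^sub>\<infinity>i\<in>{1..}. g i * f' t i)) (at t within {0..})"
proof -
  have l1: "in_l1 (f s)" "in_l1 (f' s)" if "0 \<le> s" for s
    using C1 that by (auto simp: C1_l1_def)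
  have lim: "((\<lambda>s. l1_norm (\<lambda>i. (f s i - f t i) / (s - t) - f' t i)) \<longlongrightarrow> 0) (at t within {0..})"
    using C1 \<open>0 \<le> t\<close> by (auto simp: C1_l1_def)
  have sum_g: "(\<lambda>i. g i * w i) summable_on {1..}"
    and norm_g: "\<bar>\<Sum>\<^sub>\<infinity>i\<in>{1..}. g i * w i\<bar> \<le> G * l1_norm w" if "in_l1 w" for w
  proof -
    have a: "(\<lambda>i. \<bar>w i\<bar> * \<bar>g i\<bar>) summable_on {1..}"
      using that g by (intro summable_on_mult_bounded[where G = G]) (auto simp: in_l1_def)
    then have b: "(\<lambda>i. norm (g i * w i)) summable_on {1..}"
      by (simp add: abs_mult mult.commute)
    then show "(\<lambda>i. g i * w i) summable_on {1..}"
      by (rule abs_summable_summable)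
    have c: "(\<lambda>i. G * \<bar>w i\<bar>) summable_on {1..}"
      using that by (intro summable_on_cmult_right) (simp add: in_l1_def)
    have "norm (\<Sum>\<^sub>\<infinity>i\<in>{1..}. g i * w i) \<le> (\<Sum>\<^sub>\<infinity>i\<in>{1..}. norm (g i * w i))"
      by (rule norm_infsum_bound[OF b])
    also have "\<dots> \<le> (\<Sum>\<^sub>\<infinity>i\<in>{1..}. G * \<bar>w i\<bar>)"
      using b c g by (intro infsum_mono) (auto simp: abs_mult intro: mult_right_mono)
    also have "\<dots> = G * l1_norm w"
      unfolding l1_norm_def by (rule infsum_cmult_right')
    finally show "\<bar>\<Sum>\<^sub>\<infinity>i\<in>{1..}. g i * w i\<bar> \<le> G * l1_norm w" by simp
  qed
  define u where "u s = (\<Sum>\<^sub>\<infinity>i\<in>{1..}. g i * f s i)" for s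
  define d where "d = (\<Sum>\<^sub>\<infinity>i\<in>{1..}. g i * f' t i)"
  have bound: "norm ((u s - u t) / (s - t) - d) \<le> G * l1_norm (\<lambda>i. (f s i - f t i) / (s - t) - f' t i)"
    if "0 \<le> s" for s
  proof -
    \<comment> \<open>Membership of \<open>w\<close> in the space has to be shown separately,
      because \<open>l1_norm\<close> is 0 on non-summable sequences. Division by zero being 0, the
      case \<open>s = t\<close> is covered too.\<close>
    define w where "w i = (f s i - f t i) / (s - t) - f' t i" for i
    have "(\<lambda>i. (\<bar>f s i\<bar> + \<bar>f t i\<bar>) * inverse \<bar>s - t\<bar> + \<bar>f' t i\<bar>) summable_on {1..}"
      using l1 that \<open>0 \<le> t\<close> unfolding in_l1_def
      by (intro summable_on_add summable_on_cmult_left) auto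
    then have "in_l1 w"
      unfolding in_l1_def
    proof (rule summable_on_comparison_test)
      fix i :: nat
      have "\<bar>w i\<bar> \<le> \<bar>f s i - f t i\<bar> * inverse \<bar>s - t\<bar> + \<bar>f' t i\<bar>"
        unfolding w_def using abs_triangle_ineq4[of "(f s i - f t i) / (s - t)" "f' t i"]
        by (simp add: divide_inverse abs_mult)
      also have "\<dots> \<le> (\<bar>f s i\<bar> + \<bar>f t i\<bar>) * inverse \<bar>s - t\<bar> + \<bar>f' t i\<bar>"
        by (intro add_right_mono mult_right_mono abs_triangle_ineq4) auto
      finally show "\<bar>w i\<bar> \<le> (\<bar>f s i\<bar> + \<bar>f t i\<bar>) * inverse \<bar>s - t\<bar> + \<bar>f' t i\<bar>" .
    qed auto
    have hs: "((\<lambda>i. g i * v i) has_sum (\<Sum>\<^sub>\<infinity>i\<in>{1..}. g i * v i)) {1..}" if "in_l1 v" for v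
      using sum_g[OF that] by simp
    have "((\<lambda>i. (g i * f s i + - (g i * f t i)) * inverse (s - t) + - (g i * f' t i)) has_sum
        ((u s + - u t) * inverse (s - t) + - d)) {1..}"
      unfolding u_def d_def
      by (intro has_sum_add has_sum_uminusI has_sum_cmult_left hs l1 that \<open>0 \<le> t\<close>)
    moreover have "(g i * f s i + - (g i * f t i)) * inverse (s - t) + - (g i * f' t i) = g i * w i" for i
      by (simp add: w_def divide_inverse algebra_simps)
    ultimately have "(u s - u t) / (s - t) - d = (\<Sum>\<^sub>\<infinity>i\<in>{1..}. g i * w i)"
      by (simp add: infsumI divide_inverse)
    then show ?thesis
      using norm_g[OF \<open>in_l1 w\<close>] by (simp add: w_def[abs_def])
  qed
  have "((\<lambda>s. G * l1_norm (\<lambda>i. (f s i - f t i) / (s - t) - f' t i)) \<longlongrightarrow> 0) (at t within {0..})"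
    using tendsto_mult_left[OF lim, of G] by simp
  then have "((\<lambda>s. (u s - u t) / (s - t) - d) \<longlongrightarrow> 0) (at t within {0..})"
  proof (rule Lim_null_comparison[rotated])
    show "\<forall>\<^sub>F s in at t within {0..}. norm ((u s - u t) / (s - t) - d)
        \<le> G * l1_norm (\<lambda>i. (f s i - f t i) / (s - t) - f' t i)"
      using bound by (auto simp: eventually_at_filter)
  qed
  then have "((\<lambda>s. (u s - u t) / (s - t)) \<longlongrightarrow> d) (at t within {0..})"
    by (simp add: LIM_zero_iff)
  then show ?thesis
    by (simp add: has_field_derivative_iff u_def d_def)
qed

section \<open>Estimates for the truncated moment\<close>

text \<open>The weight is constant beyond the cutoff rather than zero: particles above it still
  count in the dissipation, and that is what absorbs the \<open>S_diff\<close> terms there.\<close>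

definition cap_powr :: "real \<Rightarrow> real \<Rightarrow> nat \<Rightarrow> nat \<Rightarrow> real" where
  "cap_powr h k N i = (real (min i N) * h) powr k"

lemma cap_powr_nonneg: "0 \<le> cap_powr h k N i"
  by (simp add: cap_powr_def)

lemma cap_powr_le:
  assumes "h > 0" "0 \<le> k"
  shows "cap_powr h k N i \<le> (real N * h) powr k" "cap_powr h k N i \<le> (real i * h) powr k"
  unfolding cap_powr_def using assms by (auto intro!: powr_mono2 mult_right_mono)

text \<open>If \<open>y \<le> x\<close>, then
  \<open>(x + y) powr \<beta> n \<le> (2 * x) powr \<beta> n\<close>, and the defect estimate gives
  the first product of powers. Adding the mirrored product makes the bound valid in either
  order.\<close>

lemma kern_defect_le:
  fixes x y s k :: real
  assumes "0 < x" "0 < y" "1 < k" "0 \<le> s" "s \<le> 1" "0 < \<beta> n"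
  shows "kern \<alpha> \<beta> n x y * ((x + y) powr k - x powr k - y powr k)
    \<le> 2 powr \<beta> n * ((2 powr k - 2) * 2 powr (s / (k - 1)))
       * (x powr (\<alpha> n + \<beta> n + k - s) * y powr (\<alpha> n + s)
          + x powr (\<alpha> n + s) * y powr (\<alpha> n + \<beta> n + k - s))" (is "_ \<le> 2 powr \<beta> n * ?D * _")
proof -
  have D: "?D \<ge> 0" using two_less_two_powr[of k] assms by simp
  then have L: "2 powr \<beta> n * ?D \<ge> 0" by simp
  have main: "kern \<alpha> \<beta> n x y * ((x + y) powr k - x powr k - y powr k)
      \<le> 2 powr \<beta> n * ?D * (x powr (\<alpha> n + \<beta> n + k - s) * y powr (\<alpha> n + s))"
    if xy: "0 < y" "y \<le> x" for x y
  proof -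
    have "(x + y) powr \<beta> n \<le> (2 * x) powr \<beta> n"
      using xy assms by (intro powr_mono2) auto
    also have "\<dots> = 2 powr \<beta> n * x powr \<beta> n"
      using xy by (simp add: powr_mult)
    finally have 1: "kern \<alpha> \<beta> n x y \<le> x powr \<alpha> n * y powr \<alpha> n * (2 powr \<beta> n * x powr \<beta> n)"
      unfolding kern_def by (intro mult_left_mono) auto
    have 2: "(x + y) powr k - x powr k - y powr k \<le> ?D * (x powr (k - s) * y powr s)"
      using powr_defect_le[of k y x s] xy assms by (simp add: mult_ac)
    have "kern \<alpha> \<beta> n x y * ((x + y) powr k - x powr k - y powr k)
        \<le> (x powr \<alpha> n * y powr \<alpha> n * (2 powr \<beta> n * x powr \<beta> n)) * (?D * (x powr (k - s) * y powr s))"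
      using D powr_superadditive[of k x y] xy assms
      by (intro mult_mono 1 2) auto
    also have "\<dots> = 2 powr \<beta> n * ?D * ((x powr \<alpha> n * x powr \<beta> n * x powr (k - s)) * (y powr \<alpha> n * y powr s))"
      by (simp only: mult_ac)
    also have "x powr \<alpha> n * x powr \<beta> n * x powr (k - s) = x powr (\<alpha> n + \<beta> n + k - s)"
      by (simp add: algebra_simps flip: powr_add)
    also have "y powr \<alpha> n * y powr s = y powr (\<alpha> n + s)"
      by (simp flip: powr_add)
    finally show ?thesis .
  qed
  show ?thesis
  proof (cases "y \<le> x")
    case True
    show ?thesis
      by (rule order_trans[OF main[OF assms(2) True] mult_left_mono[OF _ L]]) simp
  next
    case False
    then have "x \<le> y" by simp
    have "kern \<alpha> \<beta> n x y * ((x + y) powr k - x powr k - y powr k)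
        = kern \<alpha> \<beta> n y x * ((y + x) powr k - y powr k - x powr k)"
      using kern_commute[of \<alpha> \<beta> n x y] by (simp add: add.commute)
    also have "\<dots> \<le> 2 powr \<beta> n * ?D * (y powr (\<alpha> n + \<beta> n + k - s) * x powr (\<alpha> n + s))"
      by (rule main[OF assms(1) \<open>x \<le> y\<close>])
    also have "\<dots> \<le> 2 powr \<beta> n * ?D * (x powr (\<alpha> n + \<beta> n + k - s) * y powr (\<alpha> n + s)
          + x powr (\<alpha> n + s) * y powr (\<alpha> n + \<beta> n + k - s))"
      by (rule mult_left_mono[OF _ L]) (simp add: mult.commute)
    finally show ?thesis .
  qed
qed

text \<open>Log-convexity of moments: \<open>p\<close> is the convex combination of the orders 1 and
  \<open>1 + r\<close> with weight \<open>(p - 1) / r\<close> on the latter, and Hoelder's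
  inequality uses these weights.\<close>

lemma sum_moment_interpolation:
  fixes f :: "nat \<Rightarrow> real"
  assumes "h > 0" "\<forall>i\<ge>1. 0 \<le> f i" "1 \<le> p" "p \<le> 1 + r" "0 < r"
  shows "(\<Sum>i=1..N. f i * (real i * h) powr p)
    \<le> (\<Sum>i=1..N. f i * (real i * h) powr 1) powr (1 - (p - 1) / r)
       * (\<Sum>i=1..N. f i * (real i * h) powr (1 + r)) powr ((p - 1) / r)"
proof -
  define \<theta> where "\<theta> = (p - 1) / r"
  have \<theta>: "0 \<le> \<theta>" "\<theta> \<le> 1" and p: "p = 1 + \<theta> * r"
    using assms by (auto simp: \<theta>_def)
  have "(\<Sum>i=1..N. f i * (real i * h) powr p)
      = (\<Sum>\<^sub>\<infinity>i\<in>{1..N}. (f i * (real i * h) powr 1) powr (1 - \<theta>) * (f i * (real i * h) powr (1 + r)) powr \<theta>)"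
    unfolding infsum_finite[OF finite_atLeastAtMost]
  proof (rule sum.cong)
    fix i assume "i \<in> {1..N}"
    then have x: "real i * h > 0" and f: "f i \<ge> 0"
      using assms by auto
    have "(f i * (real i * h) powr 1) powr (1 - \<theta>) * (f i * (real i * h) powr (1 + r)) powr \<theta>
        = (f i powr (1 - \<theta>) * f i powr \<theta>)
          * (((real i * h) powr 1) powr (1 - \<theta>) * ((real i * h) powr (1 + r)) powr \<theta>)"
      using f by (subst (1 2) powr_mult) (auto simp: mult_ac)
    also have "f i powr (1 - \<theta>) * f i powr \<theta> = f i"
      using f by (simp flip: powr_add)
    also have "((real i * h) powr 1) powr (1 - \<theta>) * ((real i * h) powr (1 + r)) powr \<theta> = (real i * h) powr p"
      unfolding powr_powr p by (simp add: algebra_simps flip: powr_add)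
    finally show "f i * (real i * h) powr p =
        (f i * (real i * h) powr 1) powr (1 - \<theta>) * (f i * (real i * h) powr (1 + r)) powr \<theta>" ..
  qed simp
  also have "\<dots> \<le> (\<Sum>\<^sub>\<infinity>i\<in>{1..N}. f i * (real i * h) powr 1) powr (1 - \<theta>)
      * (\<Sum>\<^sub>\<infinity>i\<in>{1..N}. f i * (real i * h) powr (1 + r)) powr \<theta>"
    using assms \<theta> by (intro infsum_Holder summable_on_finite) auto
  finally show ?thesis
    by (simp add: \<theta>_def)
qed

text \<open>Pairs with a member above the cutoff contribute nonpositively. On the remaining square
  the kernel bound factorises into partial moments of orders \<open>p\<close> and \<open>q\<close>,
  each interpolated between 1 and \<open>\<delta> + k\<close>; as
  \<open>p + q = 2 * \<alpha> 1 + \<beta> 1 + k\<close>, the exponents add up to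
  \<open>\<theta>\<close>. The shift \<open>s\<close> serves to bring \<open>q\<close> up to at
  least 1.\<close>

lemma coag_defect_le:
  fixes f :: "nat \<Rightarrow> real" and \<alpha> \<beta> :: "nat \<Rightarrow> real"
  assumes h: "h > 0" and f: "\<forall>i\<ge>1. 0 \<le> f i" and k: "1 < k" and \<beta>: "0 < \<beta> 1"
    and s: "0 \<le> s" "s \<le> 1" and sum: "(\<lambda>(a, b). kern \<alpha> \<beta> 1 (real a * h) (real b * h) * f a * f b
            * (cap_powr h k N (a + b) - cap_powr h k N a - cap_powr h k N b)) summable_on pairs"
    and m1: "finite_moment h 1 f"
    and p: "1 \<le> \<alpha> 1 + \<beta> 1 + k - s" "\<alpha> 1 + \<beta> 1 - s \<le> \<delta>"
    and q: "1 \<le> \<alpha> 1 + s" "\<alpha> 1 + s \<le> \<delta> + k"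
  defines "\<theta> \<equiv> (2 * \<alpha> 1 + \<beta> 1 + k - 2) / (\<delta> + k - 1)"
  assumes \<delta>: "0 < \<delta>" and \<theta>: "\<theta> \<le> 1"
  shows "(\<Sum>\<^sub>\<infinity>(a, b)\<in>pairs. kern \<alpha> \<beta> 1 (real a * h) (real b * h) * f a * f b
            * (cap_powr h k N (a + b) - cap_powr h k N a - cap_powr h k N b))
    \<le> 2 powr (\<beta> 1 + 1) * (2 powr k - 2) * 2 powr (s / (k - 1)) * moment h 1 f powr (2 - \<theta>)
       * (\<Sum>i=1..N. f i * (real i * h) powr (\<delta> + k)) powr \<theta>"
proof -
  define L where "L = 2 powr \<beta> 1 * ((2 powr k - 2) * 2 powr (s / (k - 1)))"
  have L: "L \<ge> 0" using two_less_two_powr[OF k] by (simp add: L_def)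
  define p where "p = \<alpha> 1 + \<beta> 1 + k - s"
  define q where "q = \<alpha> 1 + s"
  define w where "w e i = f i * (real i * h) powr e" for e i
  define M where "M e = (\<Sum>i=1..N. w e i)" for e
  have w: "w e i \<ge> 0" if "i \<ge> 1" for e i
    using f that by (simp add: w_def)
  have M: "M e \<ge> 0" for e
    unfolding M_def using w by (intro sum_nonneg) auto
  have "(\<Sum>\<^sub>\<infinity>(a, b)\<in>pairs. kern \<alpha> \<beta> 1 (real a * h) (real b * h) * f a * f b
            * (cap_powr h k N (a + b) - cap_powr h k N a - cap_powr h k N b))
    \<le> (\<Sum>\<^sub>\<infinity>(a, b)\<in>{1..N} \<times> {1..N}. L * (w p a * w q b + w q a * w p b))"
  proof (rule infsum_mono_neutral[OF sum])
    show "(\<lambda>(a, b). L * (w p a * w q b + w q a * w p b)) summable_on {1..N} \<times> {1..N}"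
      by (rule summable_on_finite) auto
  next
    fix z assume "z \<in> pairs \<inter> {1..N} \<times> {1..N}"
    then obtain a b where z: "z = (a, b)" "1 \<le> a" "1 \<le> b" "a \<le> N" "b \<le> N" by auto
    define x y where "x = real a * h" and "y = real b * h"
    have xy: "x > 0" "y > 0" using z h by (auto simp: x_def y_def)
    have "cap_powr h k N (a + b) \<le> (x + y) powr k"
      using cap_powr_le(2)[of h k N "a + b"] h k by (simp add: x_def y_def distrib_right)
    \<comment> \<open>The sum \<open>a + b\<close> may lie above the cutoff, where capping only
      lowers the positive term; for \<open>a\<close> and \<open>b\<close> themselves the weight is
      the exact power.\<close>
    then have "kern \<alpha> \<beta> 1 x y * (cap_powr h k N (a + b) - cap_powr h k N a - cap_powr h k N b)
        \<le> kern \<alpha> \<beta> 1 x y * ((x + y) powr k - x powr k - y powr k)"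
      using z by (intro mult_left_mono kern_nonneg) (auto simp: cap_powr_def min_def x_def y_def)
    also have "\<dots> \<le> L * (x powr p * y powr q + x powr q * y powr p)"
      using kern_defect_le[of x y k s \<beta> 1 \<alpha>] xy k s \<beta> by (simp add: L_def p_def q_def)
    finally have "f a * f b * (kern \<alpha> \<beta> 1 x y * (cap_powr h k N (a + b) - cap_powr h k N a - cap_powr h k N b))
        \<le> f a * f b * (L * (x powr p * y powr q + x powr q * y powr p))"
      using f z by (intro mult_left_mono) auto
    then show "(case z of (a, b) \<Rightarrow> kern \<alpha> \<beta> 1 (real a * h) (real b * h) * f a * f b
            * (cap_powr h k N (a + b) - cap_powr h k N a - cap_powr h k N b))
        \<le> (case z of (a, b) \<Rightarrow> L * (w p a * w q b + w q a * w p b))"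
      unfolding z x_def y_def w_def prod.case by (simp add: algebra_simps)
  next
    fix z assume "z \<in> pairs - {1..N} \<times> {1..N}"
    then obtain a b where ab: "z = (a, b)" "(a, b) \<in> pairs - {1..N} \<times> {1..N}" by (cases z) auto
    then have z: "z = (a, b)" "1 \<le> a" "1 \<le> b" "N < a \<or> N < b" by auto
    then have "cap_powr h k N (a + b) \<le> cap_powr h k N a + cap_powr h k N b"
      by (auto simp: cap_powr_def min_def)
    then show "(case z of (a, b) \<Rightarrow> kern \<alpha> \<beta> 1 (real a * h) (real b * h) * f a * f b
            * (cap_powr h k N (a + b) - cap_powr h k N a - cap_powr h k N b)) \<le> 0"
      using z f by (auto intro!: mult_nonneg_nonpos mult_nonneg_nonneg kern_nonneg)
  qed (use w L in auto)
  also have "\<dots> = (\<Sum>a=1..N. \<Sum>b=1..N. L * (w p a * w q b + w q a * w p b))"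
    by (simp add: sum.cartesian_product)
  also have "\<dots> = L * (M p * M q + M q * M p)"
    unfolding M_def sum_product by (simp add: sum.distrib sum_distrib_left distrib_left)
  also have "\<dots> = 2 * L * (M p * M q)"
    by (simp add: algebra_simps)
  also have "\<dots> \<le> 2 * L * (moment h 1 f powr (2 - \<theta>) * M (\<delta> + k) powr \<theta>)"
  proof (rule mult_left_mono)
    define r where "r = \<delta> + k - 1"
    have r: "r > 0" "1 + r = \<delta> + k" using \<delta> k by (auto simp: r_def)
    have Mp: "M p \<le> M 1 powr (1 - (p - 1) / r) * M (\<delta> + k) powr ((p - 1) / r)"
      unfolding M_def w_def
      using sum_moment_interpolation[of h f p r N] h f r assms by (simp add: p_def)
    have Mq: "M q \<le> M 1 powr (1 - (q - 1) / r) * M (\<delta> + k) powr ((q - 1) / r)"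
      unfolding M_def w_def
      using sum_moment_interpolation[of h f q r N] h f r assms by (simp add: q_def)
    have \<theta>_eq: "\<theta> = (p - 1) / r + (q - 1) / r"
      by (simp add: \<theta>_def p_def q_def r_def add.commute flip: add_divide_distrib)
    have "M p * M q \<le> (M 1 powr (1 - (p - 1) / r) * M (\<delta> + k) powr ((p - 1) / r))
        * (M 1 powr (1 - (q - 1) / r) * M (\<delta> + k) powr ((q - 1) / r))"
      by (intro mult_mono Mp Mq M mult_nonneg_nonneg) auto
    also have "\<dots> = M 1 powr (2 - \<theta>) * M (\<delta> + k) powr \<theta>"
      unfolding \<theta>_eq by (simp add: powr_add algebra_simps flip: powr_add)
    also have "\<dots> \<le> moment h 1 f powr (2 - \<theta>) * M (\<delta> + k) powr \<theta>"
    proof (intro mult_right_mono powr_mono2)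
      have "w 1 summable_on {1..}"
        using m1 unfolding finite_moment_def w_def .
      then have "sum (w 1) {1..N} \<le> infsum (w 1) {1..}"
        using w by (intro finite_sum_le_infsum) auto
      then show "M 1 \<le> moment h 1 f"
        unfolding M_def moment_def w_def .
    qed (use \<theta> M in auto)
    finally show "M p * M q \<le> moment h 1 f powr (2 - \<theta>) * M (\<delta> + k) powr \<theta>" .
  qed (use L in auto)
  also have "2 * L = 2 powr (\<beta> 1 + 1) * (2 powr k - 2) * 2 powr (s / (k - 1))"
    by (simp add: L_def powr_add)
  finally show ?thesis
    by (simp add: M_def w_def mult_ac)
qed

text \<open>Below the cutoff this is superadditivity. Above it, the weight at \<open>a + b\<close>
  is the maximal one and cancels one of the two other terms.\<close>

lemma cap_powr_diff_le:
  assumes "h > 0" "1 \<le> k" "1 \<le> a" "1 \<le> b"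
  shows "cap_powr h k N a + cap_powr h k N b - cap_powr h k N (a + b)
    \<le> (if a + b \<le> N then 0 else (real N * h) powr k)"
proof (cases "a + b \<le> N")
  case True
  then show ?thesis
    using powr_superadditive[of k "real a * h" "real b * h"] assms
    by (simp add: cap_powr_def min_def distrib_right)
next
  case False
  then have "cap_powr h k N (a + b) = (real N * h) powr k"
    by (simp add: cap_powr_def min_def)
  then show ?thesis
    using False cap_powr_le(1)[of h k N a] cap_powr_le(1)[of h k N b] assms by simp
qed

text \<open>Only pairs with \<open>a + b > N\<close> matter. There
  \<open>\<delta> > \<alpha> n + \<beta> n\<close> allows the power
  \<open>\<alpha> n + \<beta> n\<close> of the larger size to be traded for the power
  \<open>\<delta>\<close> at the cost of a factor that decays in \<open>N\<close>, and the bound on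
  the defect is the weight at \<open>a + b\<close>. Both together produce the dissipation.\<close>

lemma diff_defect_le:
  fixes f :: "nat \<Rightarrow> real" and \<alpha> \<beta> :: "nat \<Rightarrow> real"
  assumes h: "h > 0" and f: "\<forall>i\<ge>1. 0 \<le> f i" and k: "1 < k" and N: "1 \<le> N"
    and \<alpha>: "0 < \<alpha> n" and \<beta>: "0 < \<beta> n" and \<delta>: "\<alpha> n + \<beta> n < \<delta>"
    and m: "finite_moment h \<delta> f"
    and sum: "(\<lambda>(a, b). kern \<alpha> \<beta> n (real a * h) (real b * h) * f (a + b) * f b
            * (cap_powr h k N a + cap_powr h k N b - cap_powr h k N (a + b))) summable_on pairs"
  shows "(\<Sum>\<^sub>\<infinity>(a, b)\<in>pairs. kern \<alpha> \<beta> n (real a * h) (real b * h) * f (a + b) * f b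
            * (cap_powr h k N a + cap_powr h k N b - cap_powr h k N (a + b)))
    \<le> (real N * h) powr (\<alpha> n + \<beta> n - \<delta>) * moment h (\<alpha> n) f
       * (\<Sum>\<^sub>\<infinity>i\<in>{1..}. cap_powr h k N i * ((real i * h) powr \<delta> * f i))"
proof -
  define H where "H i = cap_powr h k N i * ((real i * h) powr \<delta> * f i)" for i
  define v where "v i = f i * (real i * h) powr \<alpha> n" for i
  define \<epsilon> where "\<epsilon> = (real N * h) powr (\<alpha> n + \<beta> n - \<delta>)"
  have \<epsilon>: "\<epsilon> \<ge> 0" by (simp add: \<epsilon>_def)
  have H: "H i \<ge> 0" and v: "v i \<ge> 0" if "i \<ge> 1" for i
    using f that by (auto simp: H_def v_def cap_powr_nonneg)
  have "(\<lambda>i. (f i * (real i * h) powr \<delta>) * cap_powr h k N i) summable_on {1..}"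
    by (rule summable_on_mult_bounded[where G = "(real N * h) powr k"])
       (use m f cap_powr_le(1)[of h k N] cap_powr_nonneg[of h k N] h k in \<open>auto simp: finite_moment_def\<close>)
  then have H_sum: "H summable_on {1..}"
    by (simp add: H_def[abs_def] mult_ac)
  have "finite_moment h (\<alpha> n) f"
    by (rule finite_moment_mono[of h "\<alpha> n" \<delta>]) (use assms in auto)
  then have v_sum: "v summable_on {1..}"
    by (simp add: finite_moment_def v_def[abs_def])
  note HV = has_sum_times[OF H_sum v_sum H v]
  have le: "kern \<alpha> \<beta> n (real a * h) (real b * h) * f (a + b) * f b
            * (cap_powr h k N a + cap_powr h k N b - cap_powr h k N (a + b))
        \<le> \<epsilon> * (H (a + b) * v b)" if ab: "1 \<le> a" "1 \<le> b" for a b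
  proof (cases "a + b \<le> N")
    case True
    then have "cap_powr h k N a + cap_powr h k N b - cap_powr h k N (a + b) \<le> 0"
      using cap_powr_diff_le[of h k a b N] h k ab by simp
    then have "kern \<alpha> \<beta> n (real a * h) (real b * h) * f (a + b) * f b
            * (cap_powr h k N a + cap_powr h k N b - cap_powr h k N (a + b)) \<le> 0"
      using f ab by (intro mult_nonneg_nonpos mult_nonneg_nonneg kern_nonneg) auto
    also have "0 \<le> \<epsilon> * (H (a + b) * v b)"
      using \<epsilon> H v ab by simp
    finally show ?thesis .
  next
    case False
    define z where "z = real (a + b) * h"
    have z: "z \<ge> real N * h"
      using False h by (auto simp: z_def intro!: mult_right_mono)
    have X: "real N * h > 0" using N h by simp
    have "z powr (\<alpha> n + \<beta> n - \<delta>) \<le> \<epsilon>"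
      unfolding \<epsilon>_def using X z \<delta> by (intro powr_mono2') auto
    then have "z powr \<delta> * z powr (\<alpha> n + \<beta> n - \<delta>) \<le> z powr \<delta> * \<epsilon>"
      by (intro mult_left_mono) auto
    then have "z powr (\<alpha> n + \<beta> n) \<le> z powr \<delta> * \<epsilon>"
      by (simp flip: powr_add)
    then have "f (a + b) * v b * z powr (\<alpha> n + \<beta> n) \<le> f (a + b) * v b * (z powr \<delta> * \<epsilon>)"
      using f v ab by (intro mult_left_mono) auto
    moreover have "kern \<alpha> \<beta> n (real a * h) (real b * h) * f (a + b) * f b
        \<le> f (a + b) * v b * z powr (\<alpha> n + \<beta> n)"
      using diff_pairs_le[of h \<alpha> n \<beta> f a b] h \<alpha> \<beta> f ab by (simp add: z_def v_def mult_ac)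
    ultimately have "kern \<alpha> \<beta> n (real a * h) (real b * h) * f (a + b) * f b
        \<le> f (a + b) * v b * (z powr \<delta> * \<epsilon>)"
      by linarith
    moreover have "cap_powr h k N a + cap_powr h k N b - cap_powr h k N (a + b) \<le> (real N * h) powr k"
      using cap_powr_diff_le[of h k a b N] h k ab False by simp
    moreover have "0 \<le> kern \<alpha> \<beta> n (real a * h) (real b * h) * f (a + b) * f b"
      using f ab by (intro mult_nonneg_nonneg kern_nonneg) auto
    ultimately have "kern \<alpha> \<beta> n (real a * h) (real b * h) * f (a + b) * f b
            * (cap_powr h k N a + cap_powr h k N b - cap_powr h k N (a + b))
        \<le> f (a + b) * v b * (z powr \<delta> * \<epsilon>) * (real N * h) powr k"
      by (meson mult_left_mono mult_right_mono order_trans powr_ge_zero)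
    also have "(real N * h) powr k = cap_powr h k N (a + b)"
      using False by (simp add: cap_powr_def min_def)
    finally show ?thesis
      by (simp add: H_def z_def mult_ac)
  qed
  have shear: "(\<lambda>(a, b). H (a + b) * v b) summable_on pairs"
    using summable_on_shear[OF has_sum_imp_summable[OF HV]] by simp
  have "(\<Sum>\<^sub>\<infinity>(a, b)\<in>pairs. kern \<alpha> \<beta> n (real a * h) (real b * h) * f (a + b) * f b
            * (cap_powr h k N a + cap_powr h k N b - cap_powr h k N (a + b)))
      \<le> (\<Sum>\<^sub>\<infinity>p\<in>pairs. \<epsilon> * (case p of (a, b) \<Rightarrow> H (a + b) * v b))"
    by (rule infsum_mono[OF sum summable_on_cmult_right[OF shear]]) (use le in auto)
  also have "\<dots> = \<epsilon> * (\<Sum>\<^sub>\<infinity>(a, b)\<in>pairs. H (a + b) * v b)"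
    by (rule infsum_cmult_right')
  also have "\<dots> \<le> \<epsilon> * (infsum H {1..} * infsum v {1..})"
    using infsum_shear_le[OF has_sum_imp_summable[OF HV]] H v infsumI[OF HV] \<epsilon>
    by (intro mult_left_mono) auto
  finally show ?thesis
    by (simp add: \<epsilon>_def H_def[abs_def] v_def[abs_def] moment_def mult_ac)
qed

text \<open>Hoelder's inequality with \<open>k = (1 - \<mu>) + \<mu> * (\<delta> + k)\<close>. The
  cap does no harm: the part of the capped power not assigned to the dissipation is bounded by the
  uncapped one.\<close>

lemma infsum_cap_powr_interpolation:
  fixes f :: "nat \<Rightarrow> real" and N :: nat
  assumes h: "h > 0" and f: "\<forall>i\<ge>1. 0 \<le> f i" and k: "1 < k" and \<delta>: "0 < \<delta>"
    and m1: "finite_moment h 1 f" and m\<delta>: "finite_moment h \<delta> f"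
  defines "\<mu> \<equiv> (k - 1) / (\<delta> + k - 1)"
  defines "P \<equiv> (\<Sum>\<^sub>\<infinity>i\<in>{1..}. cap_powr h k N i * ((real i * h) powr \<delta> * f i))"
  shows "(\<Sum>\<^sub>\<infinity>i\<in>{1..}. cap_powr h k N i * f i) \<le> moment h 1 f powr (1 - \<mu>) * P powr \<mu>"
proof -
  define u v where "u i = f i * (real i * h) powr 1" 
    and "v i = cap_powr h k N i * ((real i * h) powr \<delta> * f i)" for i
  have \<mu>: "0 < \<mu>" "\<mu> < 1" "\<mu> * \<delta> = (1 - \<mu>) * (k - 1)"
    using k \<delta> by (auto simp: \<mu>_def field_simps)
  have u: "u summable_on {1..}"
    using m1 by (simp add: finite_moment_def u_def[abs_def])
  have "(\<lambda>i. (f i * (real i * h) powr \<delta>) * cap_powr h k N i) summable_on {1..}"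
    by (rule summable_on_mult_bounded[where G = "(real N * h) powr k"])
       (use m\<delta> f cap_powr_le(1)[of h k N] cap_powr_nonneg[of h k N] h k in \<open>auto simp: finite_moment_def\<close>)
  then have v: "v summable_on {1..}"
    by (simp add: v_def[abs_def] mult_ac)
  have pos: "0 \<le> u i" "0 \<le> v i" if "1 \<le> i" for i
    using f that by (auto simp: u_def v_def cap_powr_nonneg)
  have le: "cap_powr h k N i * f i \<le> u i powr (1 - \<mu>) * v i powr \<mu>" if i: "1 \<le> i" for i
  proof -
    define x c where "x = real i * h" and "c = real (min i N) * h"
    have x: "x > 0" and c: "0 \<le> c" "c \<le> x"
      using h i by (auto simp: x_def c_def intro!: mult_right_mono)
    \<comment> \<open>The balance of exponents that fixes \<open>\<mu>\<close>.\<close>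
    have e: "k * (1 - \<mu>) = (1 - \<mu>) + \<delta> * \<mu>"
      using \<mu>(3) by (simp add: algebra_simps)
    have "c powr k = c powr (k * (1 - \<mu>)) * c powr (k * \<mu>)"
      by (simp add: algebra_simps flip: powr_add)
    also have "\<dots> \<le> x powr (k * (1 - \<mu>)) * c powr (k * \<mu>)"
      using c k \<mu> by (intro mult_right_mono powr_mono2) auto
    also have "\<dots> = x powr (1 - \<mu>) * (c powr (k * \<mu>) * x powr (\<delta> * \<mu>))"
      unfolding e powr_add by (simp only: mult_ac)
    finally have "c powr k * f i \<le> x powr (1 - \<mu>) * (c powr (k * \<mu>) * x powr (\<delta> * \<mu>)) * f i"
      using f i by (intro mult_right_mono) auto
    also have "f i = f i powr (1 - \<mu>) * f i powr \<mu>"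
      using f i by (simp flip: powr_add)
    also have "x powr (1 - \<mu>) * (c powr (k * \<mu>) * x powr (\<delta> * \<mu>)) * (f i powr (1 - \<mu>) * f i powr \<mu>)
        = u i powr (1 - \<mu>) * v i powr \<mu>"
    proof -
      have "u i = f i * x" "v i = c powr k * (x powr \<delta> * f i)"
        using x by (simp_all add: u_def v_def cap_powr_def x_def c_def)
      then show ?thesis
        using f i x c by (simp add: powr_mult powr_powr mult_ac)
    qed
    finally show ?thesis
      using f i by (simp add: cap_powr_def c_def flip: powr_add)
  qed
  have "(\<Sum>\<^sub>\<infinity>i\<in>{1..}. cap_powr h k N i * f i) \<le> (\<Sum>\<^sub>\<infinity>i\<in>{1..}. u i powr (1 - \<mu>) * v i powr \<mu>)"
  proof -
    \<comment> \<open>A weighted geometric mean is at most the larger entry, hence at most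
      \<open>u i + v i\<close>.\<close>
    have s: "(\<lambda>i. u i powr (1 - \<mu>) * v i powr \<mu>) summable_on {1..}"
    proof (rule summable_on_comparison_test)
      show "(\<lambda>i. u i + v i) summable_on {1..}"
        using u v by (rule summable_on_add)
      fix i :: nat assume "i \<in> {1..}"
      then have p: "0 \<le> u i" "0 \<le> v i" using pos by auto
      define z where "z = max (u i) (v i)"
      have "u i powr (1 - \<mu>) * v i powr \<mu> \<le> z powr (1 - \<mu>) * z powr \<mu>"
        using p \<mu> by (intro mult_mono powr_mono2) (auto simp: z_def)
      also have "\<dots> = z"
        using p by (simp add: z_def flip: powr_add)
      also have "\<dots> \<le> u i + v i" using p by (simp add: z_def)
      finally show "u i powr (1 - \<mu>) * v i powr \<mu> \<le> u i + v i" .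
    qed auto
    show ?thesis
    proof (rule infsum_mono)
      show "(\<lambda>i. cap_powr h k N i * f i) summable_on {1..}"
        by (rule summable_on_comparison_test[OF s])
           (use le f in \<open>auto simp: cap_powr_nonneg\<close>)
    qed (use s le in auto)
  qed
  also have "\<dots> \<le> infsum u {1..} powr (1 - \<mu>) * infsum v {1..} powr \<mu>"
    by (rule infsum_Holder[OF u v]) (use pos \<mu> in auto)
  finally show ?thesis
    by (simp add: u_def[abs_def] v_def[abs_def] moment_def P_def)
qed

text \<open>
  With \<open>A = 2 powr (\<beta> 1 + 1) * (2 powr k - 2)\<close>, the constant \<open>C_const\<close> is the maximum over \<open>M\<close> of
  \<open>A * M powr \<theta> - M / 2\<close>; taking \<open>M = A powr (1 / (1 - \<theta>))\<close> bounds it from below.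
\<close>
lemma C_const_ge:
  fixes \<alpha> \<beta> :: "nat \<Rightarrow> real"
  assumes "1 < k" "0 < 2 * \<alpha> 1 + \<beta> 1 + k - 2" "0 < \<delta> - 2 * \<alpha> 1 - \<beta> 1 + 1"
  defines "\<theta> \<equiv> (2 * \<alpha> 1 + \<beta> 1 + k - 2) / (\<delta> + k - 1)"
  shows "0 < C_const \<alpha> \<beta> \<delta> k"
    and "2 powr (\<beta> 1 + 1) * (2 powr k - 2) \<le> (2 * C_const \<alpha> \<beta> \<delta> k) powr (1 - \<theta>)"
proof -
  define A where "A = 2 powr (\<beta> 1 + 1) * (2 powr k - 2)"
  have A: "A > 0" using two_less_two_powr[of k] assms(1) by (simp add: A_def)
  have r: "\<delta> + k - 1 > 0" using assms(2,3) by linarith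
  have \<theta>: "0 < \<theta>" "\<theta> < 1" using assms r by (auto simp: \<theta>_def)
  have c: "\<delta> - 2 * \<alpha> 1 - \<beta> 1 + 1 = (1 - \<theta>) * (\<delta> + k - 1)"
    and d: "2 * \<alpha> 1 + \<beta> 1 + k - 2 = \<theta> * (\<delta> + k - 1)"
    using r by (simp_all add: \<theta>_def field_simps)
  have C: "C_const \<alpha> \<beta> \<delta> k = (1 - \<theta>) * A powr (1 / (1 - \<theta>)) * (2 * \<theta>) powr (\<theta> / (1 - \<theta>))"
  proof -
    have "(1 - \<theta>) * (\<delta> + k - 1) / (\<delta> + k - 1) = 1 - \<theta>"
      "(\<delta> + k - 1) / ((1 - \<theta>) * (\<delta> + k - 1)) = 1 / (1 - \<theta>)"
      "2 * (\<theta> * (\<delta> + k - 1)) / (\<delta> + k - 1) = 2 * \<theta>"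
      "\<theta> * (\<delta> + k - 1) / ((1 - \<theta>) * (\<delta> + k - 1)) = \<theta> / (1 - \<theta>)"
      using r by auto
    then show ?thesis
      unfolding C_const_def c d by (simp only: A_def)
  qed
  then show "0 < C_const \<alpha> \<beta> \<delta> k"
    using \<theta> A by simp
  have "(2 * C_const \<alpha> \<beta> \<delta> k) powr (1 - \<theta>)
      = (2 * (1 - \<theta>) * (A powr (1 / (1 - \<theta>)) * (2 * \<theta>) powr (\<theta> / (1 - \<theta>)))) powr (1 - \<theta>)"
    unfolding C by (simp only: mult.assoc)
  also have "\<dots> = (2 * (1 - \<theta>)) powr (1 - \<theta>)
      * ((A powr (1 / (1 - \<theta>))) powr (1 - \<theta>) * ((2 * \<theta>) powr (\<theta> / (1 - \<theta>))) powr (1 - \<theta>))"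
    using \<theta> A by (subst powr_mult) (auto simp: powr_mult)
  also have "\<dots> = (2 * (1 - \<theta>)) powr (1 - \<theta>) * (A * (2 * \<theta>) powr \<theta>)"
    using \<theta> A by (simp add: powr_powr)
  \<comment> \<open>The surplus factor \<open>(2 * (1 - \<theta>)) powr (1 - \<theta>) * (2 *
    \<theta>) powr \<theta>\<close> is at least 1 by the entropy bound.\<close>
  also have "\<dots> \<ge> A"
    using mult_left_mono[OF entropy_le_ln2[OF \<theta>], of A] A by (simp add: mult_ac)
  finally show "2 powr (\<beta> 1 + 1) * (2 powr k - 2) \<le> (2 * C_const \<alpha> \<beta> \<delta> k) powr (1 - \<theta>)"
    by (simp add: A_def)
qed

text \<open>The two conditions on \<open>u\<close> bound \<open>P powr \<mu>\<close> from below.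
  Raised to the power \<open>\<kappa>\<close>, this controls \<open>P powr (1 - \<theta>)\<close>,
  which completes \<open>P powr \<theta>\<close> to \<open>P\<close>. The factor 2 in front of
  \<open>B_fun\<close> becomes a gain \<open>2 powr \<kappa>\<close> against the loss
  \<open>2 powr (s / (k - 1))\<close>.\<close>

lemma dissipation_dominates:
  fixes \<alpha> \<beta> :: "nat \<Rightarrow> real"
  assumes k: "1 < k" and \<delta>: "0 < \<delta>" and d: "0 < 2 * \<alpha> 1 + \<beta> 1 + k - 2"
    and c: "0 < \<delta> - 2 * \<alpha> 1 - \<beta> 1 + 1"
  defines "\<theta> \<equiv> (2 * \<alpha> 1 + \<beta> 1 + k - 2) / (\<delta> + k - 1)"
    and "\<mu> \<equiv> (k - 1) / (\<delta> + k - 1)"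
  assumes m: "0 \<le> m" "m \<le> M1" and M: "0 \<le> M" "M \<le> P"
    and u: "u \<le> m powr (1 - \<mu>) * P powr \<mu>" "2 * B_fun \<alpha> \<beta> \<delta> k M1 < u"
  shows "2 powr (\<beta> 1 + 1) * (2 powr k - 2) * 2 powr (s / (k - 1)) * m powr (2 - \<theta>) * M powr \<theta>
    \<le> 2 powr (- ((\<delta> - 2 * \<alpha> 1 - \<beta> 1 + 1 - s) / (k - 1))) * P"
proof -
  define A where "A = 2 powr (\<beta> 1 + 1) * (2 powr k - 2)"
  define C where "C = C_const \<alpha> \<beta> \<delta> k"
  define r where "r = \<delta> + k - 1"
  define e where "e = 1 + r / (\<delta> - 2 * \<alpha> 1 - \<beta> 1 + 1) + \<delta> / (k - 1)"
  define \<kappa> where "\<kappa> = (\<delta> - 2 * \<alpha> 1 - \<beta> 1 + 1) / (k - 1)"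
  have A: "A > 0" using two_less_two_powr[OF k] by (simp add: A_def)
  have r: "r > 0" using k \<delta> by (simp add: r_def)
  have \<theta>: "0 < \<theta>" "\<theta> < 1" using d c r by (auto simp: \<theta>_def r_def)
  have \<mu>: "0 < \<mu>" "\<mu> < 1" using k \<delta> by (auto simp: \<mu>_def)
  have C: "C > 0" "A \<le> (2 * C) powr (1 - \<theta>)"
    using C_const_ge[of k \<alpha> \<beta> \<delta>] k d c by (auto simp: C_def A_def \<theta>_def)
  have \<kappa>: "\<kappa> > 0" using k c by (simp add: \<kappa>_def)
  have c_eq: "\<delta> - 2 * \<alpha> 1 - \<beta> 1 + 1 = (1 - \<theta>) * r" and k_eq: "k - 1 = \<mu> * r" and \<delta>_eq: "\<delta> = (1 - \<mu>) * r"
    using r by (auto simp: \<theta>_def \<mu>_def r_def field_simps)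
  have \<kappa>_eq: "\<kappa> = (1 - \<theta>) / \<mu>"
    unfolding \<kappa>_def c_eq k_eq using r by simp
  have e_eq: "e = 1 + 1 / (1 - \<theta>) + (1 - \<mu>) / \<mu>"
    unfolding e_def c_eq k_eq using r \<delta>_eq by (simp add: divide_simps)
  have B: "B_fun \<alpha> \<beta> \<delta> k M1 = (2 * C * M1 powr e) powr \<mu>"
    by (simp add: B_fun_def C_def e_def \<mu>_def r_def)
  have "0 \<le> B_fun \<alpha> \<beta> \<delta> k M1" by (simp add: B)
  then have u0: "0 < m powr (1 - \<mu>) * P powr \<mu>"
    using u by linarith
  \<comment> \<open>Strict positivity excludes both zeros, since \<open>0 powr x\<close> is
    0.\<close>
  have "m \<noteq> 0" "P \<noteq> 0" using u0 by auto
  then have pos: "m > 0" "P > 0" "M1 > 0"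
    using m M by auto
  have "m powr (1 - \<mu>) * P powr \<mu> \<le> M1 powr (1 - \<mu>) * P powr \<mu>"
    using m \<mu> by (intro mult_right_mono powr_mono2) auto
  then have "2 * (2 * C * M1 powr e) powr \<mu> \<le> M1 powr (1 - \<mu>) * P powr \<mu>"
    using u by (simp add: B)
  then have "(2 * (2 * C * M1 powr e) powr \<mu>) powr \<kappa> \<le> (M1 powr (1 - \<mu>) * P powr \<mu>) powr \<kappa>"
    using C \<kappa> by (intro powr_mono2) auto
  also have "(2 * (2 * C * M1 powr e) powr \<mu>) powr \<kappa> = 2 powr \<kappa> * ((2 * C) powr (1 - \<theta>) * M1 powr (e * (1 - \<theta>)))"
  proof -
    have "(2 * (2 * C * M1 powr e) powr \<mu>) powr \<kappa> = 2 powr \<kappa> * ((2 * C * M1 powr e) powr \<mu>) powr \<kappa>"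
      by (subst powr_mult) auto
    also have "((2 * C * M1 powr e) powr \<mu>) powr \<kappa> = (2 * C * M1 powr e) powr (1 - \<theta>)"
      using \<mu> by (simp add: powr_powr \<kappa>_eq)
    also have "\<dots> = (2 * C) powr (1 - \<theta>) * (M1 powr e) powr (1 - \<theta>)"
      using C by (subst powr_mult) auto
    finally show ?thesis by (simp add: powr_powr)
  qed
  also have "(M1 powr (1 - \<mu>) * P powr \<mu>) powr \<kappa> = M1 powr ((1 - \<mu>) * \<kappa>) * P powr (1 - \<theta>)"
    using \<mu> by (simp add: powr_mult powr_powr \<kappa>_eq)
  \<comment> \<open>The exponent \<open>e\<close> in \<open>B_fun\<close> is tuned so that, after
    the common power of \<open>M1\<close> is cancelled, exactly
    \<open>M1 powr (2 - \<theta>)\<close> remains.\<close>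
  also have "e * (1 - \<theta>) = (1 - \<mu>) * \<kappa> + (2 - \<theta>)"
    using \<theta> \<mu> by (simp add: e_eq \<kappa>_eq field_simps)
  finally have "M1 powr ((1 - \<mu>) * \<kappa>) * (2 powr \<kappa> * (2 * C) powr (1 - \<theta>) * M1 powr (2 - \<theta>))
      \<le> M1 powr ((1 - \<mu>) * \<kappa>) * P powr (1 - \<theta>)"
    by (simp only: powr_add mult_ac)
  then have "2 powr \<kappa> * (2 * C) powr (1 - \<theta>) * M1 powr (2 - \<theta>) \<le> P powr (1 - \<theta>)"
    by (rule mult_left_le_imp_le) (use pos in simp)
  moreover have "2 powr \<kappa> * A * M1 powr (2 - \<theta>) \<le> 2 powr \<kappa> * (2 * C) powr (1 - \<theta>) * M1 powr (2 - \<theta>)"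
    using C(2) by (intro mult_left_mono mult_right_mono) auto
  ultimately have key: "2 powr \<kappa> * A * M1 powr (2 - \<theta>) \<le> P powr (1 - \<theta>)"
    by linarith
  have "A * 2 powr (s / (k - 1)) * m powr (2 - \<theta>) * M powr \<theta>
      \<le> A * 2 powr (s / (k - 1)) * M1 powr (2 - \<theta>) * P powr \<theta>"
  proof (rule mult_mono[OF mult_left_mono])
    show "m powr (2 - \<theta>) \<le> M1 powr (2 - \<theta>)" "M powr \<theta> \<le> P powr \<theta>"
      using \<theta> m M by (auto intro!: powr_mono2)
  qed (use A in auto)
  also have "\<dots> = 2 powr (s / (k - 1) - \<kappa>) * P powr \<theta> * (2 powr \<kappa> * A * M1 powr (2 - \<theta>))"
    by (simp add: powr_diff)
  also have "\<dots> \<le> 2 powr (s / (k - 1) - \<kappa>) * P powr \<theta> * P powr (1 - \<theta>)"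
    by (intro mult_left_mono key) auto
  also have "\<dots> = 2 powr (s / (k - 1) - \<kappa>) * P"
    using pos by (simp flip: powr_add)
  also have "s / (k - 1) - \<kappa> = - ((\<delta> - 2 * \<alpha> 1 - \<beta> 1 + 1 - s) / (k - 1))"
    by (simp add: \<kappa>_def diff_divide_distrib add_divide_distrib)
  finally show ?thesis by (simp add: A_def)
qed

section \<open>The sign of the time derivative of the truncated moment\<close>

text \<open>Above the level, coagulation uses at most the fraction \<open>1 - \<eta>\<close> of the
  dissipation. The remaining \<open>\<eta>\<close> is shared equally by the two
  \<open>S_diff\<close> terms.\<close>

lemma truncated_moment_deriv_nonpos:
  fixes f :: "nat \<Rightarrow> real" and \<alpha> \<beta> :: "nat \<Rightarrow> real"
  assumes h: "h > 0" and f: "\<forall>i\<ge>1. 0 \<le> f i" and N: "1 \<le> N"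
    and \<alpha>\<beta>: "\<forall>n\<in>{1,2,3}. 0 < \<alpha> n \<and> 0 < \<beta> n \<and> \<alpha> n + \<beta> n < \<delta>"
    and c: "2 * \<alpha> 1 + \<beta> 1 - 1 < \<delta>" and k: "1 < k" "2 - \<alpha> 1 - \<beta> 1 < k"
    and m1: "finite_moment h 1 f" "moment h 1 f \<le> M1" and m\<delta>: "finite_moment h \<delta> f"
  defines "c \<equiv> \<delta> - 2 * \<alpha> 1 - \<beta> 1 + 1"
  defines "\<eta> \<equiv> 1 - 2 powr (- ((c - max 0 (1 - \<alpha> 1)) / (k - 1)))"
  assumes small: "\<forall>n\<in>{2,3}. (real N * h) powr (\<alpha> n + \<beta> n - \<delta>) * moment h (\<alpha> n) f \<le> \<eta> / 2"
    and large: "2 * B_fun \<alpha> \<beta> \<delta> k M1 < (\<Sum>\<^sub>\<infinity>i\<in>{1..}. cap_powr h k N i * f i)"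
  shows "(\<Sum>\<^sub>\<infinity>i\<in>{1..}. cap_powr h k N i * O_op h \<alpha> \<beta> \<delta> f i) \<le> 0"
proof -
  define g where "g = cap_powr h k N"
  have g: "\<bar>g i\<bar> \<le> (real N * h) powr k" "0 \<le> g i" for i
    using cap_powr_le(1)[of h k N i] h k by (auto simp: g_def cap_powr_nonneg)
  \<comment> \<open>The least nonnegative shift with \<open>\<alpha> 1 + s \<ge> 1\<close>, as the
    interpolation of the coagulation term requires.\<close>
  define s where "s = max 0 (1 - \<alpha> 1)"
  have pos: "0 < \<alpha> n" "0 < \<beta> n" "\<alpha> n + \<beta> n < \<delta>" if "n \<in> {1,2,3}" for n
    using \<alpha>\<beta> that by auto
  note p1 = pos[of 1, simplified]
  have fin: "finite_moment h (\<alpha> n + \<beta> n) f" if "n \<in> {1,2,3}" for n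
    by (rule finite_moment_mono[of h _ \<delta>]) (use h f m\<delta> pos[OF that] in auto)
  define P where "P = (\<Sum>\<^sub>\<infinity>i\<in>{1..}. g i * V_op h \<delta> f i)"
  have "(\<lambda>i. (f i * (real i * h) powr \<delta>) * g i) summable_on {1..}"
    by (rule summable_on_mult_bounded) (use m\<delta> f g in \<open>auto simp: finite_moment_def\<close>)
  then have P_sum: "((\<lambda>i. g i * V_op h \<delta> f i) has_sum P) {1..}"
    by (simp add: V_op_def P_def mult_ac)
  have P0: "P \<ge> 0"
    unfolding P_def V_op_def using g f by (intro infsum_nonneg) auto
  define T1 where "T1 = (\<lambda>(a, b). kern \<alpha> \<beta> 1 (real a * h) (real b * h) * f a * f b
                          * (g (a + b) - g a - g b))"
  define T where "T n = (\<lambda>(a, b). kern \<alpha> \<beta> n (real a * h) (real b * h) * f (a + b) * f b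
                          * (g a + g b - g (a + b)))" for n
  have "(\<lambda>(a, b). kern \<alpha> \<beta> 1 (real a * h) (real b * h) * f a * f b) summable_on pairs"
    by (rule summable_coag_pairs) (use h f p1 fin[of 1] in auto)
  note coag = S_coag_weak[where g = g, OF this f g(1), folded T1_def]
  have diff: "T n summable_on pairs"
      "((\<lambda>i. g i * S_diff h \<alpha> \<beta> n f i) has_sum infsum (T n) pairs) {1..}" if "n \<in> {1,2,3}" for n
  proof -
    have "(\<lambda>(a, b). kern \<alpha> \<beta> n (real a * h) (real b * h) * f (a + b) * f b) summable_on pairs"
      by (rule summable_diff_pairs) (use h f pos[OF that] fin[OF that] in auto)
    note S_diff_weak[where g = g, OF this f g(1), folded T_def]
    then show "T n summable_on pairs"
        "((\<lambda>i. g i * S_diff h \<alpha> \<beta> n f i) has_sum infsum (T n) pairs) {1..}" .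
  qed
  have "((\<lambda>i. g i * S_coag h \<alpha> \<beta> f i + g i * S_diff h \<alpha> \<beta> 2 f i + g i * S_diff h \<alpha> \<beta> 3 f i
          + - (g i * V_op h \<delta> f i)) has_sum
        (infsum T1 pairs + infsum (T 2) pairs + infsum (T 3) pairs + - P)) {1..}"
    by (intro has_sum_add has_sum_uminusI coag(2) diff(2) P_sum) auto
  then have "(\<Sum>\<^sub>\<infinity>i\<in>{1..}. g i * O_op h \<alpha> \<beta> \<delta> f i)
      = infsum T1 pairs + infsum (T 2) pairs + infsum (T 3) pairs - P"
    by (simp add: O_op_def algebra_simps infsumI)
  moreover have "infsum (T n) pairs \<le> \<eta> / 2 * P" if "n \<in> {2,3}" for n
  proof -
    have "infsum (T n) pairs
        \<le> (real N * h) powr (\<alpha> n + \<beta> n - \<delta>) * moment h (\<alpha> n) f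
          * (\<Sum>\<^sub>\<infinity>i\<in>{1..}. g i * ((real i * h) powr \<delta> * f i))"
      unfolding T_def g_def
      by (rule diff_defect_le)
         (use h f k N pos[of n] m\<delta> diff(1)[of n] fin[of n] that in \<open>auto simp: T_def g_def\<close>)
    also have "\<dots> \<le> \<eta> / 2 * (\<Sum>\<^sub>\<infinity>i\<in>{1..}. g i * ((real i * h) powr \<delta> * f i))"
      using small that P0 by (intro mult_right_mono) (auto simp: P_def V_op_def)
    finally show ?thesis by (simp add: P_def V_op_def)
  qed
  from this[of 2] this[of 3]
  have "infsum (T 2) pairs + infsum (T 3) pairs \<le> \<eta> * P"
    by simp
  moreover have "infsum T1 pairs \<le> (1 - \<eta>) * P"
  proof -
    define \<theta> where "\<theta> = (2 * \<alpha> 1 + \<beta> 1 + k - 2) / (\<delta> + k - 1)"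
    define M where "M = (\<Sum>i=1..N. f i * (real i * h) powr (\<delta> + k))"
    have "infsum T1 pairs
        \<le> 2 powr (\<beta> 1 + 1) * (2 powr k - 2) * 2 powr (s / (k - 1)) * moment h 1 f powr (2 - \<theta>) * M powr \<theta>"
      unfolding T1_def g_def M_def \<theta>_def
      by (rule coag_defect_le)
         (use h f k p1 m1 coag(1) fin[of 1] c in \<open>auto simp: T1_def g_def s_def max_def divide_le_eq_1\<close>)
    also have "\<dots> \<le> 2 powr (- ((\<delta> - 2 * \<alpha> 1 - \<beta> 1 + 1 - s) / (k - 1))) * P"
      unfolding \<theta>_def
    proof (rule dissipation_dominates)
      show "0 \<le> moment h 1 f"
        unfolding moment_def using f by (intro infsum_nonneg) auto
      show "0 \<le> M"
        unfolding M_def using f by (intro sum_nonneg) auto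
      \<comment> \<open>Up to \<open>N\<close> the cap is inactive, so \<open>M\<close> is a partial
        sum of the dissipation series.\<close>
      have "M = (\<Sum>i=1..N. g i * V_op h \<delta> f i)"
        unfolding M_def
        by (rule sum.cong) (auto simp: g_def V_op_def cap_powr_def powr_add mult_ac min_def)
      also have "\<dots> \<le> P"
        unfolding P_def
        by (rule finite_sum_le_infsum) (use P_sum g f in \<open>auto simp: V_op_def has_sum_imp_summable\<close>)
      finally show "M \<le> P" .
      show "(\<Sum>\<^sub>\<infinity>i\<in>{1..}. g i * f i) \<le> moment h 1 f powr (1 - (k - 1) / (\<delta> + k - 1)) * P powr ((k - 1) / (\<delta> + k - 1))"
        unfolding g_def P_def V_op_def
        by (rule infsum_cap_powr_interpolation) (use h f k p1 m1 m\<delta> in auto)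
      show "2 * B_fun \<alpha> \<beta> \<delta> k M1 < (\<Sum>\<^sub>\<infinity>i\<in>{1..}. g i * f i)"
        using large by (simp add: g_def)
    qed (use k p1 c m1 in auto)
    also have "2 powr (- ((\<delta> - 2 * \<alpha> 1 - \<beta> 1 + 1 - s) / (k - 1))) = 1 - \<eta>"
      by (simp add: \<eta>_def c_def s_def)
    finally show ?thesis .
  qed
  ultimately show ?thesis
    by (simp add: g_def algebra_simps)
qed

section \<open>Choice and removal of the cutoff\<close>

lemma eventually_diff_small:
  fixes \<alpha> \<beta> Q :: "nat \<Rightarrow> real"
  assumes "h > 0" "0 < \<eta>" "\<forall>n\<in>{2,3}. \<alpha> n + \<beta> n < \<delta>"
  shows "\<forall>\<^sub>F N in sequentially. \<forall>n\<in>{2,3}. (real N * h) powr (\<alpha> n + \<beta> n - \<delta>) * Q n \<le> \<eta>"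
proof (rule eventually_ball_finite)
  show "\<forall>n\<in>{2,3}. \<forall>\<^sub>F N in sequentially. (real N * h) powr (\<alpha> n + \<beta> n - \<delta>) * Q n \<le> \<eta>"
  proof
    fix n :: nat assume n: "n \<in> {2,3}"
    have "filterlim (\<lambda>N. real N * h) at_top sequentially"
      using assms(1) by (intro filterlim_at_top_mult_tendsto_pos[OF tendsto_const] filterlim_real_sequentially)
    then have "(\<lambda>N. (real N * h) powr (\<alpha> n + \<beta> n - \<delta>)) \<longlonglongrightarrow> 0"
      using assms(3) n by (intro tendsto_neg_powr) auto
    then have "(\<lambda>N. (real N * h) powr (\<alpha> n + \<beta> n - \<delta>) * Q n) \<longlonglongrightarrow> 0"
      by (rule tendsto_mult_left_zero)
    from order_tendstoD(2)[OF this assms(2)]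
    show "\<forall>\<^sub>F N in sequentially. (real N * h) powr (\<alpha> n + \<beta> n - \<delta>) * Q n \<le> \<eta>"
      by (rule eventually_mono) simp
  qed
qed simp

text \<open>Finiteness belongs to the conclusion because \<open>moment\<close> is 0 for a divergent
  series, so the bound alone would not express it.\<close>

theorem corollary2p9:
  fixes h \<delta> \<kappa> k :: real
    and \<alpha> \<beta> :: "nat \<Rightarrow> real"
    and f0 :: "nat \<Rightarrow> real"
    and f :: "real \<Rightarrow> nat \<Rightarrow> real"
  assumes "h > 0"
    and "\<forall>n\<in>{1,2,3}. \<alpha> n > 0 \<and> \<beta> n > 0"
    and "\<delta> > (MAX n\<in>{1,2,3}. \<alpha> n + \<beta> n)"
    and "\<delta> > 2 * \<alpha> 1 + \<beta> 1 - 1"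
    and "\<forall>i\<ge>1. f0 i \<ge> 0"
    and "\<kappa> > Max {\<delta>, 1, 2 - \<alpha> 1 - \<beta> 1}"
    and "finite_moment h \<kappa> f0"
    and "is_solution h \<alpha> \<beta> \<delta> \<kappa> f0 f"
    and "k > Max {\<delta>, 1, 2 - \<alpha> 1 - \<beta> 1}"
    and "finite_moment h k f0"
  shows "\<forall>t\<ge>0. finite_moment h k (f t)
           \<and> moment h k (f t) \<le> max (moment h k f0) (2 * B_fun \<alpha> \<beta> \<delta> k (moment h 1 f0))"
proof (intro allI impI)
  fix t :: real assume t: "0 \<le> t"
  note h = \<open>h > 0\<close>
  have \<alpha>\<beta>: "\<forall>n\<in>{1,2,3}. 0 < \<alpha> n \<and> 0 < \<beta> n \<and> \<alpha> n + \<beta> n < \<delta>"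
    using assms(2,3) by auto
  have k: "1 < k" "2 - \<alpha> 1 - \<beta> 1 < k" and \<kappa>: "\<delta> < \<kappa>"
    using assms(6,9) by auto
  have C1: "C1_l1 f (\<lambda>t. O_op h \<alpha> \<beta> \<delta> (f t))" and init: "\<forall>i\<ge>1. f 0 i = f0 i"
    using assms(8) by (auto simp: is_solution_def classical_solution_def)
  have f: "\<forall>i\<ge>1. 0 \<le> f t i" and m1: "finite_moment h 1 (f t)" "moment h 1 (f t) \<le> moment h 1 f0"
    and m\<kappa>: "finite_moment h \<kappa> (f t)"
      "moment h \<kappa> (f t) \<le> max (moment h \<kappa> f0) (2 * B_fun \<alpha> \<beta> \<delta> \<kappa> (moment h 1 f0))"
    if "0 \<le> t" for t
    using assms(8) that by (auto simp: is_solution_def)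
  define B where "B = 2 * B_fun \<alpha> \<beta> \<delta> k (moment h 1 f0)"
  define R where "R = max (moment h k f0) B"
  define \<eta> where "\<eta> = 1 - 2 powr (- ((\<delta> - 2 * \<alpha> 1 - \<beta> 1 + 1 - max 0 (1 - \<alpha> 1)) / (k - 1)))"
  \<comment> \<open>For \<open>\<alpha> 1 \<ge> 1\<close> this is the assumption
    \<open>\<delta> > 2 * \<alpha> 1 + \<beta> 1 - 1\<close>; otherwise it reduces to
    \<open>\<delta> > \<alpha> 1 + \<beta> 1\<close>.\<close>
  have "max 0 (1 - \<alpha> 1) < \<delta> - 2 * \<alpha> 1 - \<beta> 1 + 1"
    using \<alpha>\<beta> assms(4) by auto
  then have "2 powr (- ((\<delta> - 2 * \<alpha> 1 - \<beta> 1 + 1 - max 0 (1 - \<alpha> 1)) / (k - 1))) < 2 powr 0"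
    using k by (subst powr_less_cancel_iff) auto
  then have \<eta>: "0 < \<eta>" by (simp add: \<eta>_def)
  \<comment> \<open>A bound for the moment of order \<open>\<alpha> n\<close> that does not depend
    on time, so one threshold for \<open>N\<close> serves all times in the barrier argument.\<close>
  define Q where "Q n = h powr (\<alpha> n - \<kappa>) * max (moment h \<kappa> f0) (2 * B_fun \<alpha> \<beta> \<delta> \<kappa> (moment h 1 f0))" for n
  have Q: "moment h (\<alpha> n) (f t) \<le> Q n" if "0 \<le> t" "n \<in> {2,3}" for t n
  proof -
    have "\<alpha> n \<le> \<kappa>" using \<alpha>\<beta> \<kappa> that by force
    then have "moment h (\<alpha> n) (f t) \<le> h powr (\<alpha> n - \<kappa>) * moment h \<kappa> (f t)"
      by (rule finite_moment_mono(2)[OF h _ f[OF that(1)] m\<kappa>(1)[OF that(1)]])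
    also have "\<dots> \<le> Q n"
      unfolding Q_def using m\<kappa>(2)[OF that(1)] by (intro mult_left_mono) auto
    finally show ?thesis .
  qed
  have small: "\<forall>\<^sub>F N in sequentially. \<forall>n\<in>{2,3}. (real N * h) powr (\<alpha> n + \<beta> n - \<delta>) * Q n \<le> \<eta> / 2"
    by (rule eventually_diff_small) (use h \<eta> \<alpha>\<beta> in auto)
  have l1: "f t summable_on {1..}"
    using C1 t f[OF t] summable_on_cong[of "{1..}" "\<lambda>i. \<bar>f t i\<bar>" "f t"] by (auto simp: C1_l1_def in_l1_def)
  have cap_sum: "(\<lambda>i. cap_powr h k N i * f t i) summable_on {1..}" for N
  proof -
    have "(\<lambda>i. f t i * cap_powr h k N i) summable_on {1..}"
      by (rule summable_on_mult_bounded[OF l1, where G = "(real N * h) powr k"])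
         (use f[OF t] h k in \<open>auto simp: cap_powr_nonneg cap_powr_le\<close>)
    then show ?thesis by (simp add: mult.commute)
  qed
  have trunc: "(\<Sum>\<^sub>\<infinity>i\<in>{1..}. cap_powr h k N i * f t i) \<le> R"
    if N: "1 \<le> N" and smallN: "\<forall>n\<in>{2,3}. (real N * h) powr (\<alpha> n + \<beta> n - \<delta>) * Q n \<le> \<eta> / 2" for N
  proof -
    have "(\<Sum>\<^sub>\<infinity>i\<in>{1..}. cap_powr h k N i * f t i) \<le> max (\<Sum>\<^sub>\<infinity>i\<in>{1..}. cap_powr h k N i * f 0 i) B"
    proof (rule barrier[OF _ _ t])
      fix r :: real assume r: "0 \<le> r"
      show "((\<lambda>s. \<Sum>\<^sub>\<infinity>i\<in>{1..}. cap_powr h k N i * f s i) has_real_derivative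
          (\<Sum>\<^sub>\<infinity>i\<in>{1..}. cap_powr h k N i * O_op h \<alpha> \<beta> \<delta> (f r) i)) (at r within {0..})"
        by (rule has_real_derivative_infsum_l1[OF C1 _ r, where G = "(real N * h) powr k"])
           (use h k in \<open>auto simp: cap_powr_nonneg cap_powr_le\<close>)
      assume "B < (\<Sum>\<^sub>\<infinity>i\<in>{1..}. cap_powr h k N i * f r i)"
      moreover have "(real N * h) powr (\<alpha> n + \<beta> n - \<delta>) * moment h (\<alpha> n) (f r) \<le> \<eta> / 2" if "n \<in> {2,3}" for n
        using mult_left_mono[OF Q[OF r that], of "(real N * h) powr (\<alpha> n + \<beta> n - \<delta>)"] smallN that
        by force
      moreover have "finite_moment h \<delta> (f r)"
        by (rule finite_moment_mono[of h \<delta> \<kappa>]) (use h \<kappa> f[OF r] m\<kappa>[OF r] in auto)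
      ultimately show "(\<Sum>\<^sub>\<infinity>i\<in>{1..}. cap_powr h k N i * O_op h \<alpha> \<beta> \<delta> (f r) i) \<le> 0"
        using truncated_moment_deriv_nonpos[OF h f[OF r] N \<alpha>\<beta> assms(4) k m1[OF r]]
        unfolding B_def \<eta>_def by blast
    qed
    also have "(\<Sum>\<^sub>\<infinity>i\<in>{1..}. cap_powr h k N i * f 0 i) \<le> moment h k f0"
    proof -
      have le: "cap_powr h k N i * f0 i \<le> f0 i * (real i * h) powr k" if "1 \<le> i" for i
        using cap_powr_le(2)[of h k N i] h k assms(5) that
        by (subst mult.commute) (intro mult_left_mono, auto)
      have s: "(\<lambda>i. f0 i * (real i * h) powr k) summable_on {1..}"
        using assms(10) by (simp add: finite_moment_def)
      have "(\<Sum>\<^sub>\<infinity>i\<in>{1..}. cap_powr h k N i * f 0 i) = (\<Sum>\<^sub>\<infinity>i\<in>{1..}. cap_powr h k N i * f0 i)"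
        using init by (intro infsum_cong) auto
      also have "\<dots> \<le> moment h k f0"
        unfolding moment_def
      proof (rule infsum_mono[OF _ s])
        show "(\<lambda>i. cap_powr h k N i * f0 i) summable_on {1..}"
          by (rule summable_on_comparison_test[OF s])
             (use le assms(5) in \<open>auto simp: cap_powr_nonneg\<close>)
      qed (use le in auto)
      finally show ?thesis .
    qed
    finally show ?thesis by (simp add: R_def max.mono)
  qed
  \<comment> \<open>Finite partial sums are compared with a truncated moment whose cutoff exceeds
    their largest index. This bound, independent of the index set, yields both finiteness and the
    estimate.\<close>
  have fin_le: "(\<Sum>i\<in>F. f t i * (real i * h) powr k) \<le> R" if F: "finite F" "F \<subseteq> {1..}" for F
  proof -
    \<comment> \<open>Inserting 0 keeps \<open>Max\<close> meaningful when \<open>F\<close> is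
      empty.\<close>
    have "\<forall>\<^sub>F N in sequentially. N \<ge> max 1 (Max (insert 0 F))"
      by (rule eventually_ge_at_top)
    from eventually_happens'[OF _ eventually_conj[OF this small]] obtain N where
      N: "N \<ge> 1" "N \<ge> Max (insert 0 F)" "\<forall>n\<in>{2,3}. (real N * h) powr (\<alpha> n + \<beta> n - \<delta>) * Q n \<le> \<eta> / 2"
      by auto
    have "(\<Sum>i\<in>F. f t i * (real i * h) powr k) = (\<Sum>i\<in>F. cap_powr h k N i * f t i)"
    proof (rule sum.cong)
      fix i assume "i \<in> F"
      then have "i \<le> N" using N(2) F by simp
      then show "f t i * (real i * h) powr k = cap_powr h k N i * f t i"
        by (simp add: cap_powr_def min_def)
    qed simp
    also have "\<dots> \<le> (\<Sum>\<^sub>\<infinity>i\<in>{1..}. cap_powr h k N i * f t i)"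
      using cap_sum F f[OF t] by (intro finite_sum_le_infsum) (auto simp: cap_powr_nonneg)
    also have "\<dots> \<le> R"
      using N by (intro trunc) auto
    finally show ?thesis .
  qed
  have "finite_moment h k (f t)"
    unfolding finite_moment_def
  proof (rule nonneg_bdd_above_summable_on)
    show "bdd_above (sum (\<lambda>i. f t i * (real i * h) powr k) ` {F. F \<subseteq> {1..} \<and> finite F})"
      using fin_le by (intro bdd_aboveI2[where M = R]) auto
  qed (use f[OF t] in auto)
  moreover from this have "moment h k (f t) \<le> R"
    unfolding moment_def finite_moment_def using fin_le by (rule infsum_le_finite_sums)
  ultimately show "finite_moment h k (f t)
      \<and> moment h k (f t) \<le> max (moment h k f0) (2 * B_fun \<alpha> \<beta> \<delta> k (moment h 1 f0))"
    by (simp add: R_def B_def)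
qed

end
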